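(* Let $H=\langle a_1,a_2,a_3\rangle$ be a numerical semigroup minimally generated by three elements, $R=k[[H]]$, and let $\mathfrak a$ be the kernel of the $k$-algebra map $k[X,Y,Z]\to k[t^{a_1},t^{a_2},t^{a_3}]$, $X\mapsto t^{a_1},Y\mapsto t^{a_2},Z\mapsto t^{a_3}$. Then $R$ is a $2$-AGL ring if and only if, after a suitable permutation of $a_1,a_2,a_3$, $$\mathfrak a=\mathrm I_2\begin{pmatrix}X^2&Y&Z\\ Y^{\beta'}&Z^{\gamma'}&X^{\alpha'}\end{pmatrix}$$ for some integers $\alpha'\ge2$ and $\beta',\gamma'>0$, where $\mathrm I_2(\cdot)$ denotes the ideal generated by the $2\times2$ minors.
   Context: $k$ is a field, $V=k[[t]]$, $R=k[[t^{a_1},t^{a_2},t^{a_3}]]\subseteq V$ with $\gcd(a_1,a_2,a_3)=1$. With $f$ the Frobenius number of $H$ and $\mathrm{PF}(H)$ its pseudo-Frobenius numbers, the fractional canonical ideal is $K=\sum_{c\in\mathrm{PF}(H)}Rt^{f-c}\cong\mathrm K_R$; $S=R[K]$. $R$ is $2$-AGL iff $\ell_R(S/K)=2$ (equivalently, the Sally module of a canonical ideal with respect to a parameter reduction has rank $2$). *)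

theory Defs
  imports "HOL-Computational_Algebra.Computational_Algebra" "HOL-Library.Poly_Mapping"
          "HOL-Library.Product_Plus" "HOL-Library.Extended_Nat"
begin

definition nsg3 :: "nat \<Rightarrow> nat \<Rightarrow> nat \<Rightarrow> nat set" where
  "nsg3 a1 a2 a3 = {a1*i + a2*j + a3*l | i j l. True}"

definition nsg2 :: "nat \<Rightarrow> nat \<Rightarrow> nat set" where
  "nsg2 a b = {a*i + b*j | i j. True}"

definition min_gen3 :: "nat \<Rightarrow> nat \<Rightarrow> nat \<Rightarrow> bool" where
  "min_gen3 a1 a2 a3 \<longleftrightarrow> 0 < a1 \<and> 0 < a2 \<and> 0 < a3 \<and> gcd a1 (gcd a2 a3) = 1 \<and>
     a1 \<notin> nsg2 a2 a3 \<and> a2 \<notin> nsg2 a1 a3 \<and> a3 \<notin> nsg2 a1 a2"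

definition frobenius :: "nat set \<Rightarrow> nat" where
  "frobenius H = Max (UNIV - H)"

definition pseudo_frobenius :: "nat set \<Rightarrow> nat set" where
  "pseudo_frobenius H = {c. c \<notin> H \<and> (\<forall>h\<in>H. h \<noteq> 0 \<longrightarrow> c + h \<in> H)}"

definition sg_ring :: "nat set \<Rightarrow> 'k::field fps set" where
  "sg_ring H = {p. \<forall>n. fps_nth p n \<noteq> 0 \<longrightarrow> n \<in> H}"

definition canon_ideal :: "nat set \<Rightarrow> 'k::field fps set" where
  "canon_ideal H = {\<Sum>c\<in>pseudo_frobenius H. r c * fps_X ^ (frobenius H - c) | r.
                      \<forall>c\<in>pseudo_frobenius H. r c \<in> sg_ring H}"

inductive_set ring_adjoin :: "'a::comm_ring_1 set \<Rightarrow> 'a set \<Rightarrow> 'a set" for A B where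
  base_A: "x \<in> A \<Longrightarrow> x \<in> ring_adjoin A B"
| base_B: "x \<in> B \<Longrightarrow> x \<in> ring_adjoin A B"
| add: "x \<in> ring_adjoin A B \<Longrightarrow> y \<in> ring_adjoin A B \<Longrightarrow> x + y \<in> ring_adjoin A B"
| mult: "x \<in> ring_adjoin A B \<Longrightarrow> y \<in> ring_adjoin A B \<Longrightarrow> x * y \<in> ring_adjoin A B"
| neg: "x \<in> ring_adjoin A B \<Longrightarrow> - x \<in> ring_adjoin A B"

definition is_submodule :: "'a::comm_ring_1 set \<Rightarrow> 'a set \<Rightarrow> bool" where
  "is_submodule R M \<longleftrightarrow> 0 \<in> M \<and> (\<forall>x\<in>M. \<forall>y\<in>M. x + y \<in> M) \<and> (\<forall>r\<in>R. \<forall>x\<in>M. r * x \<in> M)"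

definition has_chain :: "'a::comm_ring_1 set \<Rightarrow> 'a set \<Rightarrow> 'a set \<Rightarrow> nat \<Rightarrow> bool" where
  "has_chain R M N n \<longleftrightarrow> (\<exists>C :: nat \<Rightarrow> 'a set. C 0 = M \<and> C n = N \<and>
      (\<forall>i\<le>n. is_submodule R (C i)) \<and> (\<forall>i<n. C i \<subset> C (Suc i)))"

text \<open>Length of the R-module N/M (M \<subseteq> N submodules), possibly infinite.\<close>
definition module_length :: "'a::comm_ring_1 set \<Rightarrow> 'a set \<Rightarrow> 'a set \<Rightarrow> enat" where
  "module_length R M N = Sup {enat n | n. has_chain R M N n}"

definition is_2AGL :: "nat set \<Rightarrow> 'k::field itself \<Rightarrow> bool" where
  "is_2AGL H _ \<longleftrightarrow>
     module_length (sg_ring H :: 'k fps set) (canon_ideal H)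
        (ring_adjoin (sg_ring H) (canon_ideal H)) = 2"

type_synonym 'k poly3 = "(nat \<times> nat \<times> nat) \<Rightarrow>\<^sub>0 'k"

definition varX :: "'k::field poly3" where "varX = Poly_Mapping.single (1,0,0) 1"
definition varY :: "'k::field poly3" where "varY = Poly_Mapping.single (0,1,0) 1"
definition varZ :: "'k::field poly3" where "varZ = Poly_Mapping.single (0,0,1) 1"

definition eval3 :: "nat \<Rightarrow> nat \<Rightarrow> nat \<Rightarrow> 'k::field poly3 \<Rightarrow> 'k poly" where
  "eval3 b1 b2 b3 p = (\<Sum>m\<in>Poly_Mapping.keys p. case m of (i,j,l) \<Rightarrow> monom (Poly_Mapping.lookup p m) (b1*i + b2*j + b3*l))"

definition def_ideal :: "nat \<Rightarrow> nat \<Rightarrow> nat \<Rightarrow> 'k::field poly3 set" where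
  "def_ideal b1 b2 b3 = {p. eval3 b1 b2 b3 p = 0}"

definition ideal_gen :: "'a::comm_ring_1 set \<Rightarrow> 'a set" where
  "ideal_gen G = {\<Sum>g\<in>F. c g * g | F c. finite F \<and> F \<subseteq> G}"

definition I2 :: "(nat \<Rightarrow> nat \<Rightarrow> 'a::comm_ring_1) \<Rightarrow> 'a set" where
  "I2 M = ideal_gen {M 0 i * M 1 j - M 0 j * M 1 i | i j. i < j \<and> j < 3}"

definition mat23 :: "'a list \<Rightarrow> 'a list \<Rightarrow> nat \<Rightarrow> nat \<Rightarrow> 'a" where
  "mat23 r0 r1 i j = (if i = 0 then r0 ! j else r1 ! j)"

end

theory Submission
  imports Defs
begin

text \<open>
  All modules involved are spanned by powers of \<open>t\<close>, so the length of \<open>S/K\<close> is the number of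
  exponents of \<open>S\<close> missing from \<open>K\<close>: a chain of submodules gives a chain of sets of orders.

  By Herzog, either two of the minimal relations \<open>c\<^sub>i a\<^sub>i = \<dots>\<close> coincide, so that \<open>H\<close> is symmetric and
  \<open>S = K = R\<close>, or the defining ideal is generated by the minors of
  \<open>(X\<^sup>\<alpha>, Y\<^sup>\<beta>, Z\<^sup>\<gamma>; Y\<^sup>\<beta>\<^sup>', Z\<^sup>\<gamma>\<^sup>', X\<^sup>\<alpha>\<^sup>')\<close>. Let \<open>d > 0\<close> be the difference of the row degrees
  (transposing \<open>Y\<close> and \<open>Z\<close> exchanges the rows), and let \<open>u\<close> be the degree of
  \<open>X\<^sup>\<alpha>\<^sup>-\<^sup>1 Y\<^sup>\<beta>\<^sup>-\<^sup>1 Z\<^sup>\<gamma>\<^sup>-\<^sup>1\<close>. The pseudo-Frobenius numbers are \<open>u + d\<close> and \<open>u + 2d\<close>, hence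
  \<open>K = R + R t\<^sup>d\<close> and \<open>S = R[t\<^sup>d]\<close>. Every divisor \<open>m\<close> of that monomial contributes the exponent
  \<open>2d + deg m\<close> to \<open>S - K\<close>, and
  \<open>2d\<close> is the only one if \<open>\<alpha> = \<beta> = \<gamma> = 1\<close>. So length \<open>2\<close> leaves only one exponent equal to \<open>2\<close> and
  the other two equal to \<open>1\<close>, say \<open>\<alpha> = 2\<close>; if moreover \<open>\<alpha>' = 1\<close>, then \<open>3d\<close> would be a third element.
\<close>

section \<open>Monomial modules of power series and their lengths\<close>

lemma sg_ringI: "(\<And>n. fps_nth p n \<noteq> 0 \<Longrightarrow> n \<in> A) \<Longrightarrow> p \<in> sg_ring A"
  by (simp add: sg_ring_def)

lemma sg_ringD: "p \<in> sg_ring A \<Longrightarrow> fps_nth p n \<noteq> 0 \<Longrightarrow> n \<in> A"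
  by (simp add: sg_ring_def)

lemma sg_ring_0 [simp]: "0 \<in> sg_ring A"
  by (simp add: sg_ring_def)

lemma sg_ring_add: "p \<in> sg_ring A \<Longrightarrow> q \<in> sg_ring A \<Longrightarrow> p + q \<in> sg_ring A"
  unfolding sg_ring_def by simp (metis add_0)

lemma sg_ring_uminus: "p \<in> sg_ring A \<Longrightarrow> - p \<in> sg_ring A"
  by (simp add: sg_ring_def)

lemma sg_ring_sum: "(\<And>i. i \<in> I \<Longrightarrow> p i \<in> sg_ring A) \<Longrightarrow> sum p I \<in> sg_ring A"
  by (induction I rule: infinite_finite_induct) (auto intro: sg_ring_add)

lemma sg_ring_mult:
  assumes "p \<in> sg_ring A" "q \<in> sg_ring B" "\<And>a b. a \<in> A \<Longrightarrow> b \<in> B \<Longrightarrow> a + b \<in> C"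
  shows "p * q \<in> sg_ring C"
proof (rule sg_ringI)
  fix n assume "fps_nth (p * q) n \<noteq> 0"
  then obtain i where i: "i \<le> n" "fps_nth p i * fps_nth q (n - i) \<noteq> 0"
    unfolding fps_mult_nth by (meson atLeastAtMost_iff sum.not_neutral_contains_not_neutral)
  then have "i \<in> A" "n - i \<in> B"
    using assms(1,2) by (auto simp: sg_ring_def)
  from assms(3)[OF this] i(1) show "n \<in> C"
    by simp
qed

lemma sg_ring_X_power_iff: "(fps_X ^ n :: 'k::field fps) \<in> sg_ring A \<longleftrightarrow> n \<in> A"
  by (auto simp: sg_ring_def fps_X_power_nth)

lemma sg_ring_const: "0 \<in> A \<Longrightarrow> fps_const c \<in> sg_ring A"
  by (auto simp: sg_ring_def split: if_splits)

lemma sg_ring_mono: "A \<subseteq> B \<Longrightarrow> sg_ring A \<subseteq> sg_ring B"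
  by (auto simp: sg_ring_def)

lemma sg_ring_psubset: "A \<subset> B \<Longrightarrow> (sg_ring A :: 'k::field fps set) \<subset> sg_ring B"
  by (metis order.strict_iff_not psubset_imp_ex_mem sg_ring_X_power_iff sg_ring_mono subset_eq subsetI)

text \<open>\<open>ring_adjoin\<close> closes only under finite sums, so the finitely many terms
  with exponents outside \<open>A\<close> are split off and \<open>q\<close> keeps the possibly
  infinite tail.\<close>

lemma sg_ring_cofinite_decomp:
  assumes "finite (B - A)" "p \<in> sg_ring B"
  obtains q where "q \<in> sg_ring A"
    "p = q + (\<Sum>n\<in>B - A. fps_const (fps_nth p n) * fps_X ^ n)"
proof
  let ?s = "\<Sum>n\<in>B - A. fps_const (fps_nth p n) * fps_X ^ n"
  have "fps_nth ?s m = (if m \<in> B - A then fps_nth p m else 0)" for m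
    using assms(1) by (auto simp: fps_sum_nth fps_X_power_nth if_distrib cong: if_cong)
  then show "p - ?s \<in> sg_ring A"
    using assms(2) by (auto simp: sg_ring_def split: if_splits)
qed simp

section \<open>The ring generated by a monomial module\<close>

inductive_set add_hull :: "nat set \<Rightarrow> nat set" for A where
  base: "x \<in> A \<Longrightarrow> x \<in> add_hull A"
| add: "x \<in> add_hull A \<Longrightarrow> y \<in> add_hull A \<Longrightarrow> x + y \<in> add_hull A"

lemma add_hull_closed:
  assumes "\<And>x y. x \<in> A \<Longrightarrow> y \<in> A \<Longrightarrow> x + y \<in> A"
  shows "add_hull A = A"
proof
  show "add_hull A \<subseteq> A"
  proof
    fix x assume "x \<in> add_hull A"
    then show "x \<in> A" by induction (auto intro: assms)
  qed
qed (auto intro: add_hull.base)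

text \<open>Cofiniteness of \<open>H\<close> leaves finitely many exponents of
  \<open>add_hull K\<close> outside \<open>H\<close>. Those terms are constants times products of
  powers taken from \<open>K\<close>; the rest already lies in the base ring.\<close>

lemma ring_adjoin_sg_ring:
  assumes "finite (UNIV - H)" "0 \<in> H" "H \<subseteq> K"
  shows "ring_adjoin (sg_ring H) (sg_ring K :: 'k::field fps set) = sg_ring (add_hull K)"
    (is "?L = _")
proof
  show "?L \<subseteq> sg_ring (add_hull K)"
  proof
    fix p assume "p \<in> ?L"
    then show "p \<in> sg_ring (add_hull K)"
    proof induction
      case (base_A x)
      with sg_ring_mono[of H "add_hull K"] assms(3) show ?case by (auto intro: add_hull.base)
    next
      case (base_B x)
      with sg_ring_mono[of K "add_hull K"] show ?case by (auto intro: add_hull.base)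
    next
      case (mult x y)
      then show ?case by (auto intro: sg_ring_mult add_hull.add)
    qed (auto intro: sg_ring_add sg_ring_uminus)
  qed
next
  have mon: "(fps_X ^ n :: 'k fps) \<in> ?L" if "n \<in> add_hull K" for n
    using that
  proof induction
    case (base x)
    then show ?case by (auto intro: ring_adjoin.base_B simp: sg_ring_X_power_iff)
  next
    case (add x y)
    then show ?case by (auto simp: power_add intro: ring_adjoin.mult)
  qed
  have "sum g F \<in> ?L" if "\<And>n. n \<in> F \<Longrightarrow> g n \<in> ?L" for g :: "nat \<Rightarrow> 'k fps" and F
    using that
    by (induction F rule: infinite_finite_induct) (auto intro: ring_adjoin.add ring_adjoin.base_A)
  moreover have "fps_const c \<in> ?L" for c
    using assms(2) by (intro ring_adjoin.base_A sg_ring_const)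
  ultimately have sums: "(\<Sum>n\<in>add_hull K - H. fps_const (c n) * fps_X ^ n) \<in> ?L" for c :: "nat \<Rightarrow> 'k"
    by (meson DiffD1 mon ring_adjoin.mult)
  show "sg_ring (add_hull K) \<subseteq> ?L"
  proof
    fix p :: "'k fps" assume p: "p \<in> sg_ring (add_hull K)"
    have "finite (add_hull K - H)"
      using assms(1) by (rule finite_subset[rotated]) auto
    then obtain q where "q \<in> sg_ring H"
      "p = q + (\<Sum>n\<in>add_hull K - H. fps_const (fps_nth p n) * fps_X ^ n)"
      using p by (rule sg_ring_cofinite_decomp)
    then show "p \<in> ?L"
      using sums[of "fps_nth p"] by (metis ring_adjoin.add ring_adjoin.base_A)
  qed
qed

section \<open>Lengths as numbers of exponents\<close>

lemma is_submodule_sg_ring: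
  assumes "\<And>h x. h \<in> H \<Longrightarrow> x \<in> A \<Longrightarrow> h + x \<in> A"
  shows "is_submodule (sg_ring H) (sg_ring A)"
  unfolding is_submodule_def using assms by (auto intro: sg_ring_add sg_ring_mult)

text \<open>Adding the largest missing exponent keeps a set closed under addition of elements of \<open>H\<close>.\<close>

lemma has_chain_sg_ring:
  assumes "finite (S - K)" "K \<subseteq> S"
    and "\<And>h x. h \<in> H \<Longrightarrow> x \<in> K \<Longrightarrow> h + x \<in> K"
    and "\<And>h x. h \<in> H \<Longrightarrow> x \<in> S \<Longrightarrow> h + x \<in> S"
  shows "has_chain (sg_ring H :: 'k::field fps set) (sg_ring K) (sg_ring S) (card (S - K))"
  using assms
proof (induction "card (S - K)" arbitrary: K)
  case 0
  then have "S - K = {}" by (metis card_0_eq)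
  with 0 have "K = S" by auto
  with 0 show ?case
    unfolding has_chain_def by (intro exI[of _ "\<lambda>_. sg_ring K"]) (auto intro: is_submodule_sg_ring)
next
  case (Suc n)
  define x where "x = Max (S - K)"
  have "S - K \<noteq> {}" using Suc.hyps(2) by force
  then have x: "x \<in> S" "x \<notin> K" using Max_in[OF Suc.prems(1)] by (auto simp: x_def)
  have max: "y \<le> x" if "y \<in> S" "y \<notin> K" for y
    using that Suc.prems(1) by (auto simp: x_def)
  have card: "card (S - insert x K) = n"
    using Suc.hyps(2) x Suc.prems(1) by (metis Diff_insert card_Diff_singleton DiffI diff_Suc_1)
  have closed: "h + y \<in> insert x K" if "h \<in> H" "y \<in> insert x K" for h y
  proof (cases "y \<in> K \<or> h = 0")
    case False
    then have "y = x" "h > 0" using that by auto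
    with max[of "h + y"] Suc.prems(4)[OF that(1)] x that show ?thesis by fastforce
  qed (use that Suc.prems(3) in auto)
  have "has_chain (sg_ring H :: 'k fps set) (sg_ring (insert x K)) (sg_ring S) n"
    using Suc.hyps(1)[of "insert x K"] card closed Suc.prems x
    by (metis Diff_insert finite_Diff insert_subset)
  then obtain C where C: "C 0 = (sg_ring (insert x K) :: 'k fps set)" "C n = sg_ring S"
    "\<And>i. i \<le> n \<Longrightarrow> is_submodule (sg_ring H) (C i)" "\<And>i. i < n \<Longrightarrow> C i \<subset> C (Suc i)"
    unfolding has_chain_def by auto
  have K: "is_submodule (sg_ring H) (sg_ring K :: 'k fps set)"
    using Suc.prems(3) by (rule is_submodule_sg_ring)
  have "(sg_ring K :: 'k fps set) \<subset> C 0"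
    unfolding C(1) using x by (intro sg_ring_psubset) auto
  then have "has_chain (sg_ring H :: 'k fps set) (sg_ring K) (sg_ring S) (Suc n)"
    unfolding has_chain_def using C K
    by (intro exI[of _ "case_nat (sg_ring K) C"]) (auto split: nat.splits)
  then show ?case using Suc.hyps(2) by simp
qed

text \<open>The value set of a module. Intermediate modules of a chain need not be spanned by powers
  of t, so they are compared through it.\<close>

definition orders :: "'k::field fps set \<Rightarrow> nat set" where
  "orders C = subdegree ` (C - {0})"

lemma orders_sg_ring: "orders (sg_ring A :: 'k::field fps set) = A"
proof
  show "orders (sg_ring A :: 'k fps set) \<subseteq> A"
  proof
    fix n assume "n \<in> orders (sg_ring A :: 'k fps set)"
    then obtain p :: "'k fps" where "p \<in> sg_ring A" "p \<noteq> 0" "n = subdegree p"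
      by (auto simp: orders_def)
    then show "n \<in> A" by (metis nth_subdegree_nonzero sg_ringD)
  qed
  show "A \<subseteq> orders (sg_ring A :: 'k fps set)"
  proof
    fix n assume "n \<in> A"
    then have "(fps_X ^ n :: 'k fps) \<in> sg_ring A - {0}"
      by (simp add: sg_ring_X_power_iff)
    moreover have "subdegree (fps_X ^ n :: 'k fps) = n" by simp
    ultimately show "n \<in> orders (sg_ring A :: 'k fps set)"
      unfolding orders_def by (metis image_eqI)
  qed
qed

text \<open>Leading terms are cancelled one at a time until the order exceeds the bound.\<close>

lemma orders_psubset:
  fixes C D :: "'k::field fps set"
  assumes H: "0 \<in> H" and C: "is_submodule (sg_ring H) C" and D: "is_submodule (sg_ring H) D"
    and high: "sg_ring {N..} \<subseteq> C" and sub: "C \<subset> D"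
  shows "orders C \<subset> orders D"
proof -
  have lin: "x + fps_const c * y \<in> M"
    if "is_submodule (sg_ring H) M" "x \<in> M" "y \<in> M" for x y c and M :: "'k fps set"
    using that sg_ring_const[OF H] unfolding is_submodule_def by blast
  have "orders C \<noteq> orders D"
  proof
    assume eq: "orders C = orders D"
    have "d \<in> C" if "d \<in> D" for d
      using that
    proof (induction "N - subdegree d" arbitrary: d rule: less_induct)
      case less
      show ?case
      proof (cases "d = 0 \<or> N \<le> subdegree d")
        case True
        then have "d \<in> sg_ring {N..}"
          by (intro sg_ringI) (metis atLeast_iff fps_zero_nth linorder_not_less
              nth_less_subdegree_zero order_less_le_trans)
        then show ?thesis using high by auto
      next
        case False
        define n where "n = subdegree d"
        have "n \<in> orders D"
          unfolding n_def orders_def using less.prems False by blast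
        then have "n \<in> orders C" using eq by simp
        then obtain c where c: "c \<in> C" "c \<noteq> 0" "subdegree c = n"
          unfolding orders_def by auto
        define a where "a = fps_nth d n / fps_nth c n"
        define e where "e = d + fps_const (- a) * c"
        have "fps_nth c n \<noteq> 0" using c by (metis nth_subdegree_nonzero)
        then have "fps_nth e i = 0" if "i \<le> n" for i
          using that c nth_less_subdegree_zero[of i c] nth_less_subdegree_zero[of i d]
          by (cases "i = n") (auto simp: e_def a_def n_def)
        moreover have "e \<in> D"
          unfolding e_def using c sub less.prems by (intro lin[OF D]) auto
        moreover have "0 \<in> C" using C by (simp add: is_submodule_def)
        ultimately have "e \<in> C"
        proof (cases "e = 0")
          case False
          then have "subdegree e > n"
            using \<open>\<And>i. i \<le> n \<Longrightarrow> fps_nth e i = 0\<close> by (intro subdegree_greaterI) auto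
          with \<open>\<not> (d = 0 \<or> N \<le> subdegree d)\<close> \<open>e \<in> D\<close> show ?thesis
            by (intro less.hyps) (auto simp: n_def)
        qed simp
        then have "e + fps_const a * c \<in> C" using c lin[OF C] by blast
        then show ?thesis
          by (simp add: e_def algebra_simps flip: fps_const_neg)
      qed
    qed
    with sub show False by auto
  qed
  moreover have "orders C \<subseteq> orders D" using sub by (auto simp: orders_def)
  ultimately show ?thesis by auto
qed

text \<open>Inserting exponents one at a time gives a chain of the claimed length. Conversely, the
  value sets of any chain grow strictly between \<open>K\<close> and \<open>S\<close>, so no chain
  is longer.\<close>

lemma module_length_sg_ring:
  assumes fin: "finite (UNIV - K)" and KS: "K \<subseteq> S" and H0: "0 \<in> H"
    and K: "\<And>h x. h \<in> H \<Longrightarrow> x \<in> K \<Longrightarrow> h + x \<in> K"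
    and S: "\<And>h x. h \<in> H \<Longrightarrow> x \<in> S \<Longrightarrow> h + x \<in> S"
  shows "module_length (sg_ring H :: 'k::field fps set) (sg_ring K) (sg_ring S) = enat (card (S - K))"
proof -
  have finSK: "finite (S - K)"
    using fin by (rule finite_subset[rotated]) auto
  \<comment> \<open>Series of order at least \<open>N\<close> all lie in \<open>sg_ring K\<close>;
    this is where the cancellation in \<open>orders_psubset\<close> may stop.\<close>
  obtain N where "UNIV - K \<subseteq> {..<N}"
    using fin finite_nat_iff_bounded by blast
  then have "{N..} \<subseteq> K" by force
  then have high: "sg_ring {N..} \<subseteq> (sg_ring K :: 'k fps set)" by (rule sg_ring_mono)
  have "n \<le> card (S - K)"
    if "has_chain (sg_ring H :: 'k fps set) (sg_ring K) (sg_ring S) n" for n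
  proof -
    from that obtain C where C: "C 0 = (sg_ring K :: 'k fps set)" "C n = sg_ring S"
      "\<And>i. i \<le> n \<Longrightarrow> is_submodule (sg_ring H) (C i)" "\<And>i. i < n \<Longrightarrow> C i \<subset> C (Suc i)"
      unfolding has_chain_def by auto
    have incr: "C i \<subseteq> C j" if "i \<le> j" "j \<le> n" for i j
      using that
    proof (induction j rule: dec_induct)
      case (step j)
      then show ?case using C(4)[of j] by auto
    qed simp
    have bounds: "sg_ring K \<subseteq> C i \<and> C i \<subseteq> sg_ring S" if "i \<le> n" for i
      using incr[of 0 i] incr[of i n] that C(1,2) by simp
    have ords: "orders (C i) \<subset> orders (C (Suc i))" if "i < n" for i
      using C(3)[of i] C(3)[of "Suc i"] C(4)[of i] bounds[of i] high that
      by (intro orders_psubset[OF H0, of _ _ N]) auto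
    have "i \<le> card (orders (C i) - K)" if "i \<le> n" for i
      using that
    proof (induction i)
      case (Suc i)
      have K0: "K \<subseteq> orders (C j)" and S0: "orders (C j) \<subseteq> S" if "j \<le> n" for j
        using bounds[OF that] orders_sg_ring[of K, where ?'k = 'k] orders_sg_ring[of S, where ?'k = 'k]
        unfolding orders_def by blast+
      have "finite (orders (C (Suc i)) - K)"
        using S0[OF Suc.prems] finSK by (meson Diff_mono finite_subset order_refl)
      moreover have "orders (C i) - K \<subset> orders (C (Suc i)) - K"
        using ords[of i] K0[of i] Suc.prems by auto
      ultimately have "card (orders (C i) - K) < card (orders (C (Suc i)) - K)"
        by (rule psubset_card_mono)
      with Suc.IH Suc.prems show ?case by linarith
    qed simp
    from this[of n] show ?thesis by (simp add: C(2) orders_sg_ring)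
  qed
  then show ?thesis
    unfolding module_length_def
    using has_chain_sg_ring[OF finSK KS K S, where ?'k = 'k]
    by (intro antisym Sup_least Sup_upper) auto
qed

section \<open>The exponents of the canonical ideal\<close>

definition canon_set :: "nat set \<Rightarrow> nat set" where
  "canon_set H = {frobenius H - c + h | c h. c \<in> pseudo_frobenius H \<and> h \<in> H}"

locale numerical_semigroup =
  fixes H :: "nat set"
  assumes zero_mem: "0 \<in> H"
    and add_mem: "x \<in> H \<Longrightarrow> y \<in> H \<Longrightarrow> x + y \<in> H"
    and finite_gaps: "finite (UNIV - H)"
    and proper: "H \<noteq> UNIV"
begin

abbreviation (input) "f \<equiv> frobenius H"
abbreviation (input) "PF \<equiv> pseudo_frobenius H"

lemma le_frobenius: "n \<notin> H \<Longrightarrow> n \<le> f"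
  unfolding frobenius_def using finite_gaps by auto

lemma frobenius_notin: "f \<notin> H"
  unfolding frobenius_def using finite_gaps proper Max_in[of "UNIV - H"] by auto

lemma PF_notin: "c \<in> PF \<Longrightarrow> c \<notin> H"
  by (simp add: pseudo_frobenius_def)

lemma frobenius_PF: "f \<in> PF"
proof -
  have "f + h \<in> H" if "h \<noteq> 0" for h
    using le_frobenius[of "f + h"] that by auto
  then show ?thesis unfolding pseudo_frobenius_def using frobenius_notin by blast
qed

lemma finite_PF: "finite PF"
  using finite_gaps by (rule finite_subset[rotated]) (auto simp: pseudo_frobenius_def)

text \<open>As long as a gap is not pseudo-Frobenius, some nonzero element of \<open>H\<close> moves
  it to a larger gap; gaps are bounded by \<open>f\<close>, so the ascent ends in
  \<open>PF\<close>.\<close>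

lemma gap_below_PF:
  assumes "n \<notin> H"
  obtains c h where "c \<in> PF" "h \<in> H" "n + h = c"
  using assms
proof (induction "f - n" arbitrary: n thesis rule: less_induct)
  case less
  show ?case
  proof (cases "n \<in> PF")
    case True
    then show ?thesis using less.prems(1)[of n 0] zero_mem by simp
  next
    case False
    then obtain h where h: "h \<in> H" "h \<noteq> 0" "n + h \<notin> H"
      using less.prems by (auto simp: pseudo_frobenius_def)
    obtain c h' where "c \<in> PF" "h' \<in> H" "n + h + h' = c"
      using less.hyps[OF _ _ h(3)] le_frobenius[OF h(3)] h(2)
      by (metis diff_less_mono2 le_neq_implies_less less_add_same_cancel1 linorder_not_less
          nat_neq_iff not_add_less1 not_gr_zero order_less_le_trans)
    then show ?thesis using less.prems(1)[of c "h + h'"] h add_mem by (simp add: add.assoc)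
  qed
qed

lemma canon_set_supset: "H \<subseteq> canon_set H"
  unfolding canon_set_def using frobenius_PF by force

text \<open>Canonical duality: if \<open>f - x\<close> is a gap, then \<open>f - x + h = c\<close>
  for some pseudo-Frobenius \<open>c\<close>, that is, \<open>x = f - c + h\<close>. Numbers above
  \<open>f\<close> lie in \<open>H\<close> anyway.\<close>

lemma mem_canon_setI:
  assumes "\<And>h. h \<in> H \<Longrightarrow> x + h \<noteq> f"
  shows "x \<in> canon_set H"
proof (cases "x \<le> f")
  case True
  then have "f - x \<notin> H" using assms[of "f - x"] by auto
  then obtain c h where "c \<in> PF" "h \<in> H" "f - x + h = c" by (rule gap_below_PF)
  moreover from this have "x = f - c + h"
    using True le_frobenius[OF PF_notin] by fastforce
  ultimately show ?thesis by (auto simp: canon_set_def)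
next
  case False
  then show ?thesis using le_frobenius canon_set_supset by fastforce
qed

text \<open>The inclusion from right to left has to distribute an infinite series over the finitely
  many generators without counting any term twice.\<close>

lemma canon_ideal_eq: "(canon_ideal H :: 'k::field fps set) = sg_ring (canon_set H)"
proof
  show "(canon_ideal H :: 'k fps set) \<subseteq> sg_ring (canon_set H)"
    unfolding canon_ideal_def
    by (auto simp: canon_set_def sg_ring_X_power_iff add.commute
        intro!: sg_ring_sum sg_ring_mult[where A = H and B = "{frobenius H - c}" for c])
next
  show "sg_ring (canon_set H) \<subseteq> (canon_ideal H :: 'k fps set)"
  proof
    fix p :: "'k fps" assume p: "p \<in> sg_ring (canon_set H)"
    have "\<exists>c. c \<in> PF \<and> (\<exists>h\<in>H. n = f - c + h)" if "n \<in> canon_set H" for n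
      using that by (auto simp: canon_set_def)
    then obtain \<phi> where \<phi>: "\<And>n. n \<in> canon_set H \<Longrightarrow> \<phi> n \<in> PF \<and> (\<exists>h\<in>H. n = f - \<phi> n + h)"
      by metis
    \<comment> \<open>\<open>\<phi>\<close> assigns each exponent to a single generator;
      \<open>r c\<close> collects the terms assigned to \<open>c\<close>, shifted down by
      \<open>f - c\<close>.\<close>
    define r where "r c = Abs_fps (\<lambda>m. if \<phi> (f - c + m) = c then fps_nth p (f - c + m) else 0)" for c
    have "r c \<in> sg_ring H" for c
    proof (rule sg_ringI)
      fix m assume "fps_nth (r c) m \<noteq> 0"
      then have "\<phi> (f - c + m) = c" "f - c + m \<in> canon_set H"
        using p by (auto simp: r_def sg_ring_def split: if_splits)
      then show "m \<in> H" using \<phi>[of "f - c + m"] by auto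
    qed
    moreover have "p = (\<Sum>c\<in>PF. r c * fps_X ^ (f - c))"
    proof (rule fps_ext)
      fix n
      have eq: "fps_nth (r c * fps_X ^ (f - c)) n = (if c = \<phi> n then fps_nth p n else 0)"
        if "c \<in> PF" for c
      proof (cases "fps_nth p n = 0")
        case True
        then show ?thesis by (auto simp: fps_X_power_mult_right_nth r_def)
      next
        case False
        then have "n \<in> canon_set H" using p by (auto dest: sg_ringD)
        with \<phi>[of n] show ?thesis by (auto simp: fps_X_power_mult_right_nth r_def)
      qed
      have "fps_nth (\<Sum>c\<in>PF. r c * fps_X ^ (f - c)) n = (\<Sum>c\<in>PF. if c = \<phi> n then fps_nth p n else 0)"
        unfolding fps_sum_nth using eq by (intro sum.cong) auto
      also have "\<dots> = (if \<phi> n \<in> PF then fps_nth p n else 0)"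
        using finite_PF by simp
      also have "\<dots> = fps_nth p n"
        using \<phi>[of n] sg_ringD[OF p, of n] by auto
      finally show "fps_nth p n = fps_nth (\<Sum>c\<in>PF. r c * fps_X ^ (f - c)) n" by simp
    qed
    ultimately show "p \<in> canon_ideal H"
      unfolding canon_ideal_def by blast
  qed
qed

text \<open>From here on the problem is purely about sets of numbers, and the field no longer
  matters.\<close>

lemma is_2AGL_iff: "is_2AGL H (k :: 'k::field itself) \<longleftrightarrow>
  card (add_hull (canon_set H) - canon_set H) = 2"
proof -
  let ?K = "canon_set H"
  have K: "h + x \<in> ?K" if "h \<in> H" "x \<in> ?K" for h x
  proof -
    from that(2) obtain c h' where "c \<in> PF" "h' \<in> H" "x = f - c + h'"
      by (auto simp: canon_set_def)
    then have "c \<in> PF" "h + h' \<in> H" "h + x = f - c + (h + h')"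
      using that(1) add_mem by auto
    then show ?thesis unfolding canon_set_def by blast
  qed
  have S: "h + x \<in> add_hull ?K" if "h \<in> H" "x \<in> add_hull ?K" for h x
    using that canon_set_supset by (auto intro: add_hull.intros)
  have "finite (UNIV - ?K)"
    using finite_gaps canon_set_supset by (meson Diff_mono finite_subset order_refl)
  then have "module_length (sg_ring H) (canon_ideal H)
      (ring_adjoin (sg_ring H) (canon_ideal H :: 'k fps set)) = enat (card (add_hull ?K - ?K))"
    unfolding canon_ideal_eq ring_adjoin_sg_ring[OF finite_gaps zero_mem canon_set_supset]
    using zero_mem K S by (intro module_length_sg_ring) (auto intro: add_hull.base)
  then show ?thesis
    unfolding is_2AGL_def by (simp add: numeral_eq_enat)
qed

end

section \<open>Herzog relations and pseudo-Frobenius numbers\<close>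

lemma zero_mem_nsg3: "0 \<in> nsg3 a1 a2 a3"
  unfolding nsg3_def by force

lemma nsg3_memI: "n = a1 * i + a2 * j + a3 * l \<Longrightarrow> n \<in> nsg3 a1 a2 a3"
  unfolding nsg3_def by blast

lemma nsg3_gens: "a1 \<in> nsg3 a1 a2 a3" "a2 \<in> nsg3 a1 a2 a3" "a3 \<in> nsg3 a1 a2 a3"
  by (rule nsg3_memI[of _ _ 1 _ 0 _ 0] nsg3_memI[of _ _ 0 _ 1 _ 0] nsg3_memI[of _ _ 0 _ 0 _ 1], simp)+

lemma nsg3_add:
  assumes "x \<in> nsg3 a1 a2 a3" "y \<in> nsg3 a1 a2 a3"
  shows "x + y \<in> nsg3 a1 a2 a3"
proof -
  obtain i j l i' j' l' where "x = a1 * i + a2 * j + a3 * l" "y = a1 * i' + a2 * j' + a3 * l'"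
    using assms unfolding nsg3_def by blast
  then show ?thesis
    by (intro nsg3_memI[of _ _ "i + i'" _ "j + j'" _ "l + l'"]) (simp add: algebra_simps)
qed

text \<open>A nonzero element contains some generator as a summand, so the pseudo-Frobenius property
  need only be tested on the three generators.\<close>

lemma nsg3_add_of_gens:
  assumes "c + a1 \<in> nsg3 a1 a2 a3" "c + a2 \<in> nsg3 a1 a2 a3" "c + a3 \<in> nsg3 a1 a2 a3"
    and "h \<in> nsg3 a1 a2 a3" "h \<noteq> 0"
  shows "c + h \<in> nsg3 a1 a2 a3"
proof -
  let ?H = "nsg3 a1 a2 a3"
  obtain i j l where h: "h = a1 * i + a2 * j + a3 * l"
    using assms(4) unfolding nsg3_def by blast
  with assms(5) consider i' where "i = Suc i'" | j' where "j = Suc j'" | l' where "l = Suc l'"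
    by (cases i; cases j; cases l) auto
  then show ?thesis
  proof cases
    case 1
    then have "c + h = (c + a1) + (a1 * i' + a2 * j + a3 * l)" using h by simp
    then show ?thesis using nsg3_add[OF assms(1) nsg3_memI[OF refl]] by metis
  next
    case 2
    then have "c + h = (c + a2) + (a1 * i + a2 * j' + a3 * l)" using h by simp
    then show ?thesis using nsg3_add[OF assms(2) nsg3_memI[OF refl]] by metis
  next
    case 3
    then have "c + h = (c + a3) + (a1 * i + a2 * j + a3 * l')" using h by simp
    then show ?thesis using nsg3_add[OF assms(3) nsg3_memI[OF refl]] by metis
  qed
qed

text \<open>From \<open>m * m\<close> on, the quotient of \<open>n\<close> by \<open>m\<close> is at
  least the remainder, so \<open>n\<close> is a sum of quotient-many terms, remainder-many of them
  \<open>Suc m\<close> and the others \<open>m\<close>.\<close>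

lemma finite_compl_of_consecutive:
  fixes H :: "nat set"
  assumes "0 \<in> H" "\<And>x y. x \<in> H \<Longrightarrow> y \<in> H \<Longrightarrow> x + y \<in> H" "m \<in> H" "Suc m \<in> H"
  shows "finite (UNIV - H)"
proof -
  have mult: "x * n \<in> H" if "x \<in> H" for x n
    by (induction n) (auto intro: assms that)
  have "n \<in> H" if "m * m \<le> n" for n
  proof (cases "m = 0")
    case True
    then show ?thesis using mult[OF assms(4), of n] by simp
  next
    case False
    have q: "m \<le> n div m" using that False by (simp add: less_eq_div_iff_mult_less_eq)
    moreover have "n mod m \<le> m" using False by (simp add: less_imp_le)
    ultimately have "m * (n div m - n mod m) + Suc m * (n mod m) = m * (n div m) + n mod m"
      by (simp add: diff_mult_distrib2)
    then have "n = m * (n div m - n mod m) + Suc m * (n mod m)"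
      by simp
    then show ?thesis using assms(2) mult assms(3,4) by metis
  qed
  then have "UNIV - H \<subseteq> {..<m * m}"
    by (metis DiffE lessThan_iff linorder_not_less subsetI)
  then show ?thesis by (rule finite_subset) simp
qed

lemma nsg3_finite_compl:
  assumes "gcd a1 (gcd a2 a3) = 1"
  shows "finite (UNIV - nsg3 a1 a2 a3)"
proof -
  let ?H = "nsg3 a1 a2 a3"
  obtain u v where uv: "u * int a1 + v * int (gcd a2 a3) = 1"
    using bezout_int[of "int a1" "int (gcd a2 a3)"] assms by (metis gcd_int_int_eq int_ops(2))
  obtain x y where "x * int a2 + y * int a3 = int (gcd a2 a3)"
    using bezout_int[of "int a2" "int a3"] by (metis gcd_int_int_eq)
  with uv have "u * int a1 + (v * x) * int a2 + (v * y) * int a3 = 1"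
    by (metis (no_types, lifting) add.assoc distrib_left mult.assoc)
  then obtain p q r where pqr: "p * int a1 + q * int a2 + r * int a3 = 1" by blast
  \<comment> \<open>The negative terms of the Bezout identity, moved to the other side, give
    \<open>m\<close>; the positive terms give \<open>Suc m\<close>.\<close>
  define m where "m = a1 * nat (- p) + a2 * nat (- q) + a3 * nat (- r)"
  have "Suc m = a1 * nat p + a2 * nat q + a3 * nat r"
  proof -
    have split: "s * int a = int (a * nat s) - int (a * nat (- s))" for a s
      by (cases "s \<ge> 0") auto
    have "int (Suc m) = int (a1 * nat p + a2 * nat q + a3 * nat r)"
      using pqr unfolding m_def split[of p a1] split[of q a2] split[of r a3] of_nat_add of_nat_Suc
      by linarith
    then show ?thesis by (rule of_nat_eq_iff[THEN iffD1])
  qed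
  then have "Suc m \<in> ?H" by (rule nsg3_memI)
  moreover have "m \<in> ?H" unfolding m_def by (rule nsg3_memI) simp
  ultimately show ?thesis
    using finite_compl_of_consecutive[of ?H m] zero_mem_nsg3 nsg3_add by blast
qed

section \<open>Exponents of Herzog's matrix, normal forms and the Apery set\<close>

definition deg3 :: "nat \<Rightarrow> nat \<Rightarrow> nat \<Rightarrow> nat \<times> nat \<times> nat \<Rightarrow> nat" where
  "deg3 b1 b2 b3 m = (case m of (i, j, l) \<Rightarrow> b1 * i + b2 * j + b3 * l)"

lemma deg3_simp [simp]: "deg3 b1 b2 b3 (i, j, l) = b1 * i + b2 * j + b3 * l"
  by (simp add: deg3_def)

text \<open>The numerical content of the matrix with rows
  \<open>X^\<alpha>, Y^\<beta>, Z^\<gamma>\<close> and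
  \<open>Y^\<beta>', Z^\<gamma>', X^\<alpha>'\<close>: \<open>rel1\<close> to \<open>rel3\<close>
  make its minors homogeneous for the weights \<open>b1\<close>, \<open>b2\<close>,
  \<open>b3\<close>, and \<open>min1\<close> to \<open>min3\<close> make the pure powers in them the
  least possible.\<close>

locale herzog =
  fixes b1 b2 b3 \<alpha> \<beta> \<gamma> \<alpha>' \<beta>' \<gamma>' :: nat
  assumes pos: "0 < b1" "0 < b2" "0 < b3" "0 < \<alpha>" "0 < \<beta>" "0 < \<gamma>" "0 < \<alpha>'" "0 < \<beta>'" "0 < \<gamma>'"
    and coprime: "gcd b1 (gcd b2 b3) = 1"
    and rel1: "(\<alpha> + \<alpha>') * b1 = \<beta>' * b2 + \<gamma> * b3"
    and rel2: "(\<beta> + \<beta>') * b2 = \<alpha> * b1 + \<gamma>' * b3"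
    and rel3: "(\<gamma> + \<gamma>') * b3 = \<alpha>' * b1 + \<beta> * b2"
    and min1: "0 < c \<Longrightarrow> c * b1 = y * b2 + z * b3 \<Longrightarrow> \<alpha> + \<alpha>' \<le> c"
    and min2: "0 < c \<Longrightarrow> c * b2 = x * b1 + z * b3 \<Longrightarrow> \<beta> + \<beta>' \<le> c"
    and min3: "0 < c \<Longrightarrow> c * b3 = x * b1 + y * b2 \<Longrightarrow> \<gamma> + \<gamma>' \<le> c"
begin

text \<open>Rotating the variables rotates the columns of the matrix; this later brings any chosen
  column to the front.\<close>

lemma cyclic: "herzog b2 b3 b1 \<beta> \<gamma> \<alpha> \<beta>' \<gamma>' \<alpha>'"
proof (unfold_locales, goal_cases)
  case 10
  then show ?case using coprime by (metis gcd.assoc gcd.commute)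
next
  case (14 c y z)
  then show ?case using min2[of c z y] by simp
next
  case (15 c x z)
  then show ?case using min3[of c z x] by simp
next
  case (16 c x y)
  then show ?case using min1[of c x y] by simp
qed (use pos rel1 rel2 rel3 in auto)

text \<open>Swapping the last two variables exchanges the rows and reverses the columns, so either
  row may be taken as the first.\<close>

lemma transpose: "herzog b1 b3 b2 \<alpha>' \<gamma>' \<beta>' \<alpha> \<gamma> \<beta>"
proof (unfold_locales, goal_cases)
  case 10
  then show ?case using coprime by (metis gcd.commute)
next
  case (14 c y z)
  then show ?case using min1[of c z y] by simp
next
  case (15 c x z)
  then show ?case using min3[of c x z] by simp
next
  case (16 c x y)
  then show ?case using min2[of c x y] by simp
qed (use pos rel1 rel2 rel3 in \<open>auto simp: add.commute\<close>)

text \<open>The L-shaped region of exponents of the monomials in Y and Z divisible by none of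
  \<open>Y^(\<beta>+\<beta>')\<close>, \<open>Z^(\<gamma>+\<gamma>')\<close> and
  \<open>Y^\<beta>' Z^\<gamma>\<close>.\<close>

definition box :: "nat \<Rightarrow> nat \<Rightarrow> bool" where
  "box j l \<longleftrightarrow> j < \<beta> + \<beta>' \<and> l < \<gamma> + \<gamma>' \<and> (j < \<beta>' \<or> l < \<gamma>)"

text \<open>Common factors are cancelled. If Y or Z alone is left on the box side, minimality
  contradicts the size of the box; the remaining case reduces to these by
  \<open>rel1\<close>.\<close>

lemma box_unique:
  assumes "box j l" and eq: "j * b2 + l * b3 = i * b1 + y * b2 + z * b3"
  shows "i = 0 \<and> y = j \<and> z = l"
proof (cases "j \<le> y")
  case True
  then obtain d where d: "y = j + d" using le_Suc_ex by blast
  show ?thesis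
  proof (cases "l \<le> z")
    case True
    then obtain e where "z = l + e" using le_Suc_ex by blast
    then have "i * b1 + d * b2 + e * b3 = 0" using eq d by (simp add: algebra_simps)
    then show ?thesis using pos d \<open>z = l + e\<close> by simp
  next
    case False
    then obtain e where e: "l = z + e" "0 < e" using less_imp_add_positive not_le by blast
    then have "e * b3 = i * b1 + d * b2" using eq d by (simp add: algebra_simps)
    then have "\<gamma> + \<gamma>' \<le> e" using min3 e by blast
    then show ?thesis using e assms(1) by (simp add: box_def)
  qed
next
  case False
  then obtain d where d: "j = y + d" "0 < d" using less_imp_add_positive not_le by blast
  show ?thesis
  proof (cases "l \<le> z")
    case True
    then obtain e where "z = l + e" using le_Suc_ex by blast
    then have "d * b2 = i * b1 + e * b3" using eq d by (simp add: algebra_simps)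
    then have "\<beta> + \<beta>' \<le> d" using min2 d by blast
    then show ?thesis using d assms(1) by (simp add: box_def)
  next
    case False
    then obtain e where e: "l = z + e" "0 < e" using less_imp_add_positive not_le by blast
    have ib: "i * b1 = d * b2 + e * b3" using eq d e by (simp add: algebra_simps)
    moreover have "0 < d * b2" using d pos by simp
    ultimately have "0 < i" by (cases i) auto
    \<comment> \<open>\<open>i\<close> is large enough to replace
      \<open>\<alpha> + \<alpha>'\<close> copies of \<open>b1\<close> by the right side of
      \<open>rel1\<close>; what is left after cancelling has Y or Z alone on one side.\<close>
    with ib min1 have "\<alpha> + \<alpha>' \<le> i" by blast
    then obtain m where "i = \<alpha> + \<alpha>' + m" using le_Suc_ex by blast
    with ib have sub: "d * b2 + e * b3 = m * b1 + \<beta>' * b2 + \<gamma> * b3"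
      using rel1 by (simp add: algebra_simps)
    show ?thesis
    proof (cases "\<beta>' \<le> d")
      case True
      then obtain d' where d': "d = \<beta>' + d'" using le_Suc_ex by blast
      have "e < \<gamma>" using assms(1) True d e by (auto simp: box_def)
      then obtain e' where e': "\<gamma> = e + e'" "0 < e'" using less_imp_add_positive by blast
      have "d' * b2 = m * b1 + e' * b3"
        using sub unfolding d' e'(1) by (simp add: algebra_simps)
      moreover from this have "0 < d'" using e' pos by (cases d') auto
      ultimately have "\<beta> + \<beta>' \<le> d'" using min2 by blast
      then show ?thesis using d d' assms(1) by (simp add: box_def)
    next
      case False
      then obtain d' where d': "\<beta>' = d + d'" "0 < d'" using less_imp_add_positive not_le by blast
      have e3: "e * b3 = m * b1 + d' * b2 + \<gamma> * b3"
        using sub unfolding d'(1) by (simp add: algebra_simps)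
      then have "\<gamma> * b3 < e * b3" using d' pos by (simp add: add_pos_pos)
      then have "\<gamma> < e" by simp
      then obtain e' where e': "e = \<gamma> + e'" "0 < e'" using less_imp_add_positive by blast
      have "e' * b3 = m * b1 + d' * b2"
        using e3 unfolding e'(1) by (simp add: algebra_simps)
      then have "\<gamma> + \<gamma>' \<le> e'" using min3 e' by blast
      then show ?thesis using e e' assms(1) by (simp add: box_def)
    qed
  qed
qed

text \<open>Each rewriting step preserves the degree and raises the exponent of \<open>X\<close>, so it terminates.\<close>

lemma normal_form:
  fixes R :: "nat \<times> nat \<times> nat \<Rightarrow> nat \<times> nat \<times> nat \<Rightarrow> bool"
  assumes refl: "\<And>m. R m m" and trans: "\<And>m n p. R m n \<Longrightarrow> R n p \<Longrightarrow> R m p"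
    and step1: "\<And>i j l. R (i, j + \<beta>', l + \<gamma>) (i + (\<alpha> + \<alpha>'), j, l)"
    and step2: "\<And>i j l. R (i, j + (\<beta> + \<beta>'), l) (i + \<alpha>, j, l + \<gamma>')"
    and step3: "\<And>i j l. R (i, j, l + (\<gamma> + \<gamma>')) (i + \<alpha>', j + \<beta>, l)"
  shows "\<exists>i' j' l'. R (i, j, l) (i', j', l') \<and> box j' l'"
proof (induction "j * b2 + l * b3" arbitrary: i j l rule: less_induct)
  case less
  have step: ?case if "R (i, j, l) (x, y, z)" "y * b2 + z * b3 < j * b2 + l * b3" for x y z
    using less[OF that(2), of x] trans[OF that(1)] by blast
  show ?case
  proof (cases "box j l")
    case True
    then show ?thesis using refl by blast
  next
    case False
    then consider "\<beta> + \<beta>' \<le> j" | "\<gamma> + \<gamma>' \<le> l" | "\<beta>' \<le> j" "\<gamma> \<le> l"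
      by (auto simp: box_def)
    then show ?thesis
    proof cases
      case 1
      then obtain y where y: "j = y + (\<beta> + \<beta>')" by (metis add.commute le_Suc_ex)
      have "0 < \<alpha> * b1" using pos by simp
      then have "y * b2 + (l + \<gamma>') * b3 < j * b2 + l * b3"
        using rel2 unfolding y by (simp add: algebra_simps)
      with step2[of i y l] y show ?thesis by (intro step) auto
    next
      case 2
      then obtain z where z: "l = z + (\<gamma> + \<gamma>')" by (metis add.commute le_Suc_ex)
      have "0 < \<alpha>' * b1" using pos by simp
      then have "(j + \<beta>) * b2 + z * b3 < j * b2 + l * b3"
        using rel3 unfolding z by (simp add: algebra_simps)
      with step3[of i j z] z show ?thesis by (intro step) auto
    next
      case 3
      then obtain y z where yz: "j = y + \<beta>'" "l = z + \<gamma>" by (metis add.commute le_Suc_ex)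
      have "0 < \<beta>' * b2" using pos by simp
      then have "y * b2 + z * b3 < j * b2 + l * b3"
        unfolding yz by (simp add: algebra_simps)
      with step1[of i y z] yz show ?thesis by (intro step) auto
    qed
  qed
qed

abbreviation deg :: "nat \<times> nat \<times> nat \<Rightarrow> nat" where
  "deg \<equiv> deg3 b1 b2 b3"

lemma deg_step:
  "deg (i, j + \<beta>', l + \<gamma>) = deg (i + (\<alpha> + \<alpha>'), j, l)"
  "deg (i, j + (\<beta> + \<beta>'), l) = deg (i + \<alpha>, j, l + \<gamma>')"
  "deg (i, j, l + (\<gamma> + \<gamma>')) = deg (i + \<alpha>', j + \<beta>, l)"
  using rel1 rel2 rel3 by (auto simp: algebra_simps)

lemma mem_box:
  assumes "h \<in> nsg3 b1 b2 b3"
  obtains i j l where "h = b1 * i + b2 * j + b3 * l" "box j l"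
proof -
  obtain i j l where "h = deg (i, j, l)"
    using assms unfolding nsg3_def by auto
  moreover obtain i' j' l' where "deg (i, j, l) = deg (i', j', l')" "box j' l'"
    \<comment> \<open>Only degrees are tracked here; for the defining ideal the relation is
      congruence modulo the minors.\<close>
    using normal_form[of "\<lambda>m n. deg m = deg n" i j l] deg_step by auto
  ultimately show ?thesis using that by simp
qed

text \<open>The degrees of the box monomials form the Apery set with respect to \<open>b1\<close>.\<close>

lemma notin_of_box:
  assumes "box j l" "n + b1 = b2 * j + b3 * l"
  shows "n \<notin> nsg3 b1 b2 b3"
proof
  assume "n \<in> nsg3 b1 b2 b3"
  then obtain i y z where "n = b1 * i + b2 * y + b3 * z"
    unfolding nsg3_def by blast
  then have "j * b2 + l * b3 = Suc i * b1 + y * b2 + z * b3"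
    using assms(2) by (simp add: algebra_simps)
  from box_unique[OF assms(1) this] show False by simp
qed

end

text \<open>The two rows of the matrix differ in degree; \<open>d\<close> is this difference.\<close>

locale herzog_shift = herzog +
  fixes d :: nat
  assumes d_pos: "0 < d" and row1: "\<alpha> * b1 + d = \<beta>' * b2"
begin

abbreviation (input) "H \<equiv> nsg3 b1 b2 b3"

lemma row2: "\<beta> * b2 + d = \<gamma>' * b3"
  using rel2 row1 by (simp add: algebra_simps)

lemma row3: "\<gamma> * b3 + d = \<alpha>' * b1"
  using rel1 row1 by (simp add: algebra_simps)

lemma cyclic_shift: "herzog_shift b2 b3 b1 \<beta> \<gamma> \<alpha> \<beta>' \<gamma>' \<alpha>' d"
  using cyclic d_pos row2 by (simp add: herzog_shift_def herzog_shift_axioms_def)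

definition u :: nat where
  "u = (\<alpha> - 1) * b1 + (\<beta> - 1) * b2 + (\<gamma> - 1) * b3"

lemma u_plus: "u + b1 + b2 + b3 = \<alpha> * b1 + \<beta> * b2 + \<gamma> * b3"
  using pos by (auto simp: u_def gr0_conv_Suc)

text \<open>The box has two maximal corners; their degrees less \<open>b1\<close> are the candidates
  for pseudo-Frobenius numbers.\<close>

lemma box_corner1: "box (\<beta> + \<beta>' - 1) (\<gamma> - 1)"
  using pos by (auto simp: box_def)

lemma box_corner2: "box (\<beta>' - 1) (\<gamma> + \<gamma>' - 1)"
  using pos by (auto simp: box_def)

lemma corner1: "u + d + b1 = b2 * (\<beta> + \<beta>' - 1) + b3 * (\<gamma> - 1)"
proof -
  have "b2 * (\<beta> + \<beta>' - 1) + b2 = b2 * \<beta> + b2 * \<beta>'" "b3 * (\<gamma> - 1) + b3 = b3 * \<gamma>"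
    using pos by (auto simp: gr0_conv_Suc algebra_simps)
  then show ?thesis using u_plus row1 by (simp add: algebra_simps)
qed

lemma corner2: "u + 2 * d + b1 = b2 * (\<beta>' - 1) + b3 * (\<gamma> + \<gamma>' - 1)"
proof -
  have "b2 * (\<beta>' - 1) + b2 = b2 * \<beta>'" "b3 * (\<gamma> + \<gamma>' - 1) + b3 = b3 * \<gamma> + b3 * \<gamma>'"
    using pos by (auto simp: gr0_conv_Suc algebra_simps)
  then show ?thesis using u_plus row1 row2 by (simp add: algebra_simps)
qed

lemma gaps: "u + d \<notin> H" "u + 2 * d \<notin> H"
  using notin_of_box[OF box_corner1 corner1] notin_of_box[OF box_corner2 corner2] by auto

text \<open>\<open>c + b1\<close> lies in the Apery set, so it is the degree of a box monomial.
  Since \<open>c + b2\<close> and \<open>c + b3\<close> are in \<open>H\<close>, both neighbours of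
  that monomial leave the box, and it is one of the two corners.\<close>

lemma PF_cases:
  assumes "c \<in> pseudo_frobenius H"
  shows "c = u + d \<or> c = u + 2 * d"
proof -
  have cH: "c \<notin> H" and plus: "\<And>h. h \<in> H \<Longrightarrow> h \<noteq> 0 \<Longrightarrow> c + h \<in> H"
    using assms by (auto simp: pseudo_frobenius_def)
  have cb: "c + b1 \<in> H" "c + b2 \<in> H" "c + b3 \<in> H"
    using plus nsg3_gens pos by auto
  from cb(1) obtain i j l where ijl: "c + b1 = b1 * i + b2 * j + b3 * l" "box j l"
    by (rule mem_box)
  have "i = 0"
  proof (rule ccontr)
    assume "i \<noteq> 0"
    then obtain i' where "i = Suc i'" using not0_implies_Suc by blast
    then have "c = b1 * i' + b2 * j + b3 * l" using ijl by simp
    then show False using cH nsg3_memI by blast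
  qed
  have "\<not> box (Suc j) l" "\<not> box j (Suc l)"
    using notin_of_box[of "Suc j" l "c + b2"] notin_of_box[of j "Suc l" "c + b3"] cb ijl \<open>i = 0\<close>
    by auto
  then have "j = \<beta> + \<beta>' - 1 \<and> l = \<gamma> - 1 \<or> j = \<beta>' - 1 \<and> l = \<gamma> + \<gamma>' - 1"
    using ijl(2) by (auto simp: box_def)
  then show ?thesis
    using ijl(1) \<open>i = 0\<close> corner1 corner2 by auto
qed

text \<open>Adding \<open>b2\<close> or \<open>b3\<close> completes a power
  \<open>\<beta> * b2\<close> or \<open>\<gamma> * b3\<close>, whose sum with \<open>d\<close> is an
  entry of the second row; for \<open>b1\<close> the corner itself is a representation.\<close>

lemma PF_shift: "u + d \<in> pseudo_frobenius H"
proof -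
  have "u + d + b1 \<in> H"
    by (rule nsg3_memI[of _ _ 0]) (use corner1 in simp)
  moreover have "u + d + b2 \<in> H"
  proof (rule nsg3_memI)
    have "(\<beta> - 1) * b2 + b2 = \<beta> * b2" using pos by (auto simp: gr0_conv_Suc)
    then show "u + d + b2 = b1 * (\<alpha> - 1) + b2 * 0 + b3 * (\<gamma> - 1 + \<gamma>')"
      using row2 by (simp add: u_def algebra_simps)
  qed
  moreover have "u + d + b3 \<in> H"
  proof (rule nsg3_memI)
    have "(\<gamma> - 1) * b3 + b3 = \<gamma> * b3" using pos by (auto simp: gr0_conv_Suc)
    then show "u + d + b3 = b1 * (\<alpha> - 1 + \<alpha>') + b2 * (\<beta> - 1) + b3 * 0"
      using row3 by (simp add: u_def algebra_simps)
  qed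
  ultimately show ?thesis
    unfolding pseudo_frobenius_def using gaps nsg3_add_of_gens[of "u + d"] by blast
qed

sublocale nsg: numerical_semigroup H
  using gaps by unfold_locales (auto intro: zero_mem_nsg3 nsg3_add nsg3_finite_compl[OF coprime])

text \<open>The Frobenius number is one of the two candidates and is at least the gap
  \<open>u + 2 * d\<close>.\<close>

lemma frobenius_eq: "frobenius H = u + 2 * d"
  using nsg.le_frobenius[OF gaps(2)] PF_cases[OF nsg.frobenius_PF] d_pos by auto

lemma PF_eq: "pseudo_frobenius H = {u + d, u + 2 * d}"
  using PF_cases PF_shift nsg.frobenius_PF frobenius_eq by auto

lemma canon_set_eq: "canon_set H = H \<union> {d + h | h. h \<in> H}"
proof -
  have "canon_set H = (\<Union>c\<in>{u + d, u + 2 * d}. {u + 2 * d - c + h | h. h \<in> H})"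
    unfolding canon_set_def PF_eq frobenius_eq by blast
  then show ?thesis by auto
qed

lemma add_hull_eq: "add_hull (canon_set H) = {n * d + h | n h. h \<in> H}"
proof
  show "add_hull (canon_set H) \<subseteq> {n * d + h | n h. h \<in> H}"
  proof
    fix x assume "x \<in> add_hull (canon_set H)"
    then show "x \<in> {n * d + h | n h. h \<in> H}"
    proof induction
      case (base x)
      then consider "x \<in> H" | h where "x = d + h" "h \<in> H" by (auto simp: canon_set_eq)
      then show ?case
      proof cases
        case 1
        then have "x = 0 * d + x \<and> x \<in> H" by simp
        then show ?thesis by blast
      next
        case 2
        then have "x = 1 * d + h \<and> h \<in> H" by simp
        then show ?thesis by blast
      qed
    next
      case (add x y)
      then obtain n h m k where "x = n * d + h" "y = m * d + k" "h \<in> H" "k \<in> H" by blast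
      then have "x + y = (n + m) * d + (h + k) \<and> h + k \<in> H"
        by (simp add: algebra_simps nsg3_add)
      then show ?case by blast
    qed
  qed
next
  have "n * d + h \<in> add_hull (canon_set H)" if "h \<in> H" for n h
  proof (induction n)
    case 0
    then show ?case using that by (simp add: canon_set_eq add_hull.base)
  next
    case (Suc n)
    have "d + 0 \<in> canon_set H"
      unfolding canon_set_eq using zero_mem_nsg3 by blast
    then have "d + (n * d + h) \<in> add_hull (canon_set H)"
      using Suc by (auto intro: add_hull.intros)
    then show ?case by (simp add: add.assoc)
  qed
  then show "{n * d + h | n h. h \<in> H} \<subseteq> add_hull (canon_set H)" by blast
qed

section \<open>Counting the exponents of S missing from K\<close>

definition D :: "nat set" where
  "D = add_hull (canon_set H) - canon_set H"

text \<open>Being outside \<open>K\<close> means having a complement \<open>h\<close> in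
  \<open>H\<close> up to the Frobenius number. If \<open>x\<close> were in \<open>K\<close>, that
  complement would put \<open>u + 2 * d\<close> or \<open>u + d\<close> into
  \<open>H\<close>.\<close>

lemma mem_D_iff: "x \<in> D \<longleftrightarrow> (\<exists>n. \<exists>h\<in>H. x = n * d + h) \<and> (\<exists>h\<in>H. x + h = u + 2 * d)"
proof -
  have "x \<notin> canon_set H" if "h \<in> H" "x + h = u + 2 * d" for h
  proof
    assume "x \<in> canon_set H"
    then consider "x \<in> H" | k where "k \<in> H" "x = d + k" by (auto simp: canon_set_eq)
    then show False
    proof cases
      case 1
      then show ?thesis using that nsg3_add gaps(2) by metis
    next
      case 2
      then have "u + d = k + h" using that by simp
      then show ?thesis using 2 that nsg3_add gaps(1) by metis
    qed
  qed
  moreover have "\<exists>h\<in>H. x + h = u + 2 * d" if "x \<notin> canon_set H"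
    using nsg.mem_canon_setI[of x] that unfolding frobenius_eq by blast
  ultimately show ?thesis unfolding D_def add_hull_eq by blast
qed

lemma mem_D:
  assumes "i < \<alpha>" "j < \<beta>" "l < \<gamma>"
  shows "2 * d + (b1 * i + b2 * j + b3 * l) \<in> D"
proof -
  \<comment> \<open>The complementary divisor of the monomial of degree \<open>u\<close> provides
    the complement required by \<open>mem_D_iff\<close>.\<close>
  obtain i' j' l' where "\<alpha> - 1 = i + i'" "\<beta> - 1 = j + j'" "\<gamma> - 1 = l + l'"
    using assms by (metis le_Suc_ex Suc_leI Suc_diff_1 Suc_le_mono less_nat_zero_code not_gr_zero)
  then have "2 * d + (b1 * i + b2 * j + b3 * l) + (b1 * i' + b2 * j' + b3 * l') = u + 2 * d"
    by (simp add: u_def algebra_simps)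
  then show ?thesis
    unfolding mem_D_iff using nsg3_memI[OF refl] by blast
qed

lemma gens_neq: "b1 \<noteq> b2" "b1 \<noteq> b3"
  using min1[of 1 1 0] min1[of 1 0 1] pos by auto

lemma card_D_2_imp:
  assumes "card D = 2" "2 \<le> \<alpha>"
  shows "\<alpha> = 2 \<and> \<beta> = 1 \<and> \<gamma> = 1 \<and> 2 \<le> \<alpha>'"
proof -
  have fin: "finite D" using assms(1) by (metis card.infinite zero_neq_numeral)
  have D: "2 * d \<in> D" "2 * d + b1 \<in> D"
    using mem_D[of 0 0 0] mem_D[of 1 0 0] pos assms(2) by auto
  \<comment> \<open>With two elements already known, every further divisor of the monomial of degree
    \<open>u\<close> would be one too many.\<close>
  have third: "x = 2 * d \<or> x = 2 * d + b1" if "x \<in> D" for x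
  proof (rule ccontr)
    assume "\<not> ?thesis"
    then have "card {2 * d, 2 * d + b1, x} = 3" using pos by auto
    moreover have "card {2 * d, 2 * d + b1, x} \<le> card D"
      using D that fin by (intro card_mono) auto
    ultimately show False using assms(1) by simp
  qed
  have \<alpha>: "\<alpha> = 2"
    using mem_D[of 2 0 0] third[of "2 * d + b1 * 2"] pos assms(2) by (cases "\<alpha> = 2") auto
  moreover have \<beta>: "\<beta> = 1"
    using mem_D[of 0 1 0] third[of "2 * d + b2"] pos gens_neq by (cases "\<beta> = 1") auto
  moreover have \<gamma>: "\<gamma> = 1"
    using mem_D[of 0 0 1] third[of "2 * d + b3"] pos gens_neq by (cases "\<gamma> = 1") auto
  moreover have "\<alpha>' \<noteq> 1"
  proof
    assume "\<alpha>' = 1"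
    then have b3d: "b3 + d = b1" using row3 \<gamma> by simp
    \<comment> \<open>Here \<open>u = b1 = b3 + d\<close>, so \<open>3 * d\<close> has complement
      \<open>b3\<close>; it is new because \<open>d\<close> is neither 0 nor
      \<open>b1\<close>.\<close>
    have "3 * d + b3 = u + 2 * d"
      unfolding u_def using b3d \<alpha> \<beta> \<gamma> by simp
    moreover have "3 * d = 3 * d + 0 \<and> 0 \<in> H" using zero_mem_nsg3 by simp
    ultimately have "3 * d \<in> D" unfolding mem_D_iff using nsg3_gens(3) by blast
    then show False using third[of "3 * d"] d_pos b3d pos by auto
  qed
  ultimately show ?thesis using pos by auto
qed

text \<open>Otherwise \<open>u = 0\<close>. Writing an element as \<open>n * d + h\<close> with
  complement \<open>k\<close>, the values 0 and 1 of \<open>n\<close> put a gap into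
  \<open>H\<close>, and \<open>n \<ge> 2\<close> leaves only \<open>2 * d\<close>.\<close>

lemma card_D_2_nontrivial:
  assumes "card D = 2"
  shows "2 \<le> \<alpha> \<or> 2 \<le> \<beta> \<or> 2 \<le> \<gamma>"
proof (rule ccontr)
  assume "\<not> ?thesis"
  then have "u = 0" using pos by (auto simp: u_def)
  have "x = 2 * d" if x: "x \<in> D" for x
  proof -
    obtain n h k where nhk: "x = n * d + h" "h \<in> H" "k \<in> H" "x + k = 2 * d"
      using x \<open>u = 0\<close> unfolding mem_D_iff by auto
    have sum: "h + k \<in> H" using nhk nsg3_add by blast
    have "n \<noteq> 0"
    proof
      assume "n = 0"
      then have "u + 2 * d = h + k" using nhk \<open>u = 0\<close> by simp
      then show False using sum gaps(2) by simp
    qed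
    moreover have "n \<noteq> 1"
    proof
      assume "n = 1"
      then have "u + d = h + k" using nhk \<open>u = 0\<close> by simp
      then show False using sum gaps(1) by simp
    qed
    ultimately obtain m where "n = m + 2" by (metis One_nat_def add_2_eq_Suc' not0_implies_Suc)
    with nhk show ?thesis by (simp add: algebra_simps)
  qed
  then have "D \<subseteq> {2 * d}" by auto
  then have "card D \<le> 1" using card_mono[of "{2 * d}" D] by simp
  then show False using assms by simp
qed

text \<open>This keeps \<open>b1\<close> from splitting further in \<open>card_D_eq_2\<close>. Each
  \<open>d\<close> trades one \<open>b2\<close> for \<open>\<gamma>' * b3\<close> by
  \<open>row2\<close>; once no \<open>b2\<close> is left, \<open>b3 + d = \<alpha>' * b1\<close>
  alone exceeds \<open>b1\<close>.\<close>

lemma b1_not_shifted: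
  assumes "2 \<le> \<alpha>'" "\<beta> = 1" "\<gamma> = 1" "j + l \<noteq> 0"
  shows "b1 \<noteq> b2 * j + b3 * l + n * d"
  using assms(4)
proof (induction n arbitrary: j l)
  case 0
  show ?case
  proof
    assume "b1 = b2 * j + b3 * l + 0 * d"
    then have "1 * b1 = j * b2 + l * b3" by (simp add: mult.commute)
    then have "\<alpha> + \<alpha>' \<le> 1" by (intro min1) auto
    then show False using assms(1) by simp
  qed
next
  case (Suc n)
  show ?case
  proof (cases j)
    case 0
    then obtain z where l: "l = Suc z" using Suc.prems by (metis add_0 not0_implies_Suc)
    have "b3 + d = \<alpha>' * b1" using row3 assms by simp
    moreover have "2 * b1 \<le> \<alpha>' * b1" using assms by simp
    moreover have "b3 \<le> b3 * l" "d \<le> Suc n * d" using l by simp_all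
    ultimately show ?thesis using d_pos by linarith
  next
    case j: (Suc y)
    have "b2 * j + b3 * l + Suc n * d = b2 * y + b3 * (l + \<gamma>') + n * d"
      using row2 assms j by (simp add: algebra_simps)
    then show ?thesis using Suc.IH[of y "l + \<gamma>'"] pos by simp
  qed
qed

text \<open>Now \<open>u = b1\<close>. An element \<open>n * d + h\<close> with complement
  \<open>k\<close> has \<open>n \<ge> 2\<close>, as smaller \<open>n\<close> would put a gap into
  \<open>H\<close>, and then \<open>b1 = (n - 2) * d + (h + k)\<close> admits only trivial
  splittings.\<close>

lemma card_D_eq_2:
  assumes "\<alpha> = 2" "\<beta> = 1" "\<gamma> = 1" "2 \<le> \<alpha>'"
  shows "card D = 2"
proof -
  have u: "u = b1" unfolding u_def using assms by simp
  have D: "2 * d \<in> D" "2 * d + b1 \<in> D"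
    using mem_D[of 0 0 0] mem_D[of 1 0 0] assms by auto
  have "x = 2 * d \<or> x = 2 * d + b1" if x: "x \<in> D" for x
  proof -
    obtain n h k where nhk: "x = n * d + h" "h \<in> H" "k \<in> H" "x + k = b1 + 2 * d"
      using x u unfolding mem_D_iff by auto
    have sum: "h + k \<in> H" using nhk nsg3_add by blast
    have "n \<noteq> 0"
    proof
      assume "n = 0"
      then have "u + 2 * d = h + k" using nhk u by simp
      then show False using sum gaps(2) by simp
    qed
    moreover have "n \<noteq> 1"
    proof
      assume "n = 1"
      then have "u + d = h + k" using nhk u by simp
      then show False using sum gaps(1) by simp
    qed
    ultimately obtain m where m: "n = m + 2" by (metis One_nat_def add_2_eq_Suc' not0_implies_Suc)
    have b1: "b1 = m * d + (h + k)" using nhk m by (simp add: algebra_simps)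
    obtain i j l where ijl: "h + k = b1 * i + b2 * j + b3 * l"
      using sum unfolding nsg3_def by blast
    show ?thesis
    proof (cases i)
      case 0
      then have "h + k = b2 * j + b3 * l" using ijl by simp
      then have "b1 = b2 * j + b3 * l + m * d" using b1 by linarith
      with b1_not_shifted[OF assms(4,2,3), of j l m] have "j + l = 0" by argo
      \<comment> \<open>\<open>b1\<close> may then be a multiple of \<open>d\<close>; with
        complement 0 the element is still \<open>2 * d + b1\<close>.\<close>
      then have "k = 0" using ijl 0 by simp
      then show ?thesis using nhk by simp
    next
      case (Suc i')
      then have "m * d + b1 * i' + b2 * j + b3 * l = 0" using b1 ijl by (simp add: algebra_simps)
      then have "h + k = b1" "m = 0" using b1 d_pos by auto
      moreover have "h = 0 \<or> k = 0"
      proof (rule ccontr)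
        assume hk: "\<not> (h = 0 \<or> k = 0)"
        \<comment> \<open>Nonzero summands of \<open>b1\<close> are smaller than \<open>b1\<close>,
          so they use only the other two generators.\<close>
        have only: "\<exists>y z. w = b2 * y + b3 * z" if wH: "w \<in> H" "w < b1" for w
        proof -
          obtain p y z where w: "w = b1 * p + b2 * y + b3 * z"
            using wH(1) unfolding nsg3_def by blast
          then have "p = 0" using wH(2) by (cases p) auto
          then show ?thesis using w by auto
        qed
        obtain y z y' z' where yz: "h = b2 * y + b3 * z" "k = b2 * y' + b3 * z'"
          using only[of h] only[of k] nhk hk \<open>h + k = b1\<close> by auto
        then have "b1 = b2 * (y + y') + b3 * (z + z') + 0 * d"
          using \<open>h + k = b1\<close> by (simp add: algebra_simps)
        then show False
          using b1_not_shifted[of "y + y'" "z + z'" 0] assms hk yz by auto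
      qed
      ultimately have "x = 2 * d + h" "h = 0 \<or> h = b1" using nhk(1) m by auto
      then show ?thesis by auto
    qed
  qed
  then have "D = {2 * d, 2 * d + b1}" using D by auto
  then show ?thesis using pos by simp
qed

end

section \<open>Existence of Herzog relations\<close>

lemma nsg3_swap12: "nsg3 a1 a2 a3 = nsg3 a2 a1 a3"
proof -
  have "nsg3 x y z \<subseteq> nsg3 y x z" for x y z
  proof
    fix n assume "n \<in> nsg3 x y z"
    then obtain i j l where "n = x * i + y * j + z * l" unfolding nsg3_def by blast
    then show "n \<in> nsg3 y x z" by (intro nsg3_memI[of _ _ j _ i _ l]) simp
  qed
  then show ?thesis by blast
qed

lemma nsg3_swap23: "nsg3 a1 a2 a3 = nsg3 a1 a3 a2"
proof -
  have "nsg3 x y z \<subseteq> nsg3 x z y" for x y z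
  proof
    fix n assume "n \<in> nsg3 x y z"
    then obtain i j l where "n = x * i + y * j + z * l" unfolding nsg3_def by blast
    then show "n \<in> nsg3 x z y" by (intro nsg3_memI[of _ _ i _ l _ j]) simp
  qed
  then show ?thesis by blast
qed

lemma nsg2_swap: "nsg2 a b = nsg2 b a"
  unfolding nsg2_def by (auto simp: add.commute)

lemma min_gen3_swap12: "min_gen3 a1 a2 a3 \<longleftrightarrow> min_gen3 a2 a1 a3"
  unfolding min_gen3_def by (auto simp: nsg2_swap gcd.left_commute)

lemma min_gen3_swap23: "min_gen3 a1 a2 a3 \<longleftrightarrow> min_gen3 a1 a3 a2"
  unfolding min_gen3_def by (auto simp: nsg2_swap gcd.commute)

lemma mset3_eq_cases:
  assumes "mset [b1, b2, b3] = mset [a1, a2, a3]"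
  shows "(b1, b2, b3) \<in> {(a1, a2, a3), (a1, a3, a2), (a2, a1, a3), (a2, a3, a1), (a3, a1, a2), (a3, a2, a1)}"
  using assms by (auto simp: add_eq_conv_ex)

lemma perm_nsg3: "mset [b1, b2, b3] = mset [a1, a2, a3] \<Longrightarrow> nsg3 b1 b2 b3 = nsg3 a1 a2 a3"
  using mset3_eq_cases[of b1 b2 b3 a1 a2 a3] nsg3_swap12 nsg3_swap23 by (simp, metis)

lemma perm_min_gen3: "mset [b1, b2, b3] = mset [a1, a2, a3] \<Longrightarrow> min_gen3 b1 b2 b3 = min_gen3 a1 a2 a3"
  using mset3_eq_cases[of b1 b2 b3 a1 a2 a3] min_gen3_swap12 min_gen3_swap23 by (simp, metis)

lemma numerical_semigroup_nsg3:
  assumes "min_gen3 a1 a2 a3"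
  shows "numerical_semigroup (nsg3 a1 a2 a3)"
proof
  have *: "x \<in> nsg2 1 y" "x \<in> nsg2 y 1" for x y
    unfolding nsg2_def by (auto intro: exI[of _ x] exI[of _ 0])
  have "1 \<notin> nsg3 a1 a2 a3"
  proof
    assume "1 \<in> nsg3 a1 a2 a3"
    then obtain i j l where "a1 * i + a2 * j + a3 * l = 1" unfolding nsg3_def by auto
    then have "a1 * i = 1 \<or> a2 * j = 1 \<or> a3 * l = 1" by linarith
    then have "a1 = 1 \<or> a2 = 1 \<or> a3 = 1" by auto
    then show False using assms * unfolding min_gen3_def by metis
  qed
  then show "nsg3 a1 a2 a3 \<noteq> UNIV" by auto
  show "finite (UNIV - nsg3 a1 a2 a3)"
    using assms by (intro nsg3_finite_compl) (simp add: min_gen3_def)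
qed (auto intro: zero_mem_nsg3 nsg3_add)

section \<open>Least relations with positive coefficients\<close>

definition least_rel :: "nat \<Rightarrow> nat \<Rightarrow> nat \<Rightarrow> nat \<Rightarrow> bool" where
  "least_rel b1 b2 b3 c \<longleftrightarrow> 0 < c \<and> (\<exists>y z. c * b1 = y * b2 + z * b3) \<and>
     (\<forall>c' y z. 0 < c' \<longrightarrow> c' * b1 = y * b2 + z * b3 \<longrightarrow> c \<le> c')"

lemma least_rel_pos: "least_rel b1 b2 b3 c \<Longrightarrow> 0 < c"
  and least_rel_obtain: "least_rel b1 b2 b3 c \<Longrightarrow> \<exists>y z. c * b1 = y * b2 + z * b3"
  and least_rel_le: "least_rel b1 b2 b3 c \<Longrightarrow> 0 < c' \<Longrightarrow> c' * b1 = y * b2 + z * b3 \<Longrightarrow> c \<le> c'"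
  by (auto simp: least_rel_def)

lemma least_rel_swap: "least_rel b1 b2 b3 c \<longleftrightarrow> least_rel b1 b3 b2 c"
  unfolding least_rel_def by (metis add.commute)

lemma least_rel_exists:
  assumes "0 < b2"
  shows "\<exists>c. least_rel b1 b2 b3 c"
proof -
  define P where "P c \<longleftrightarrow> 0 < c \<and> (\<exists>y z. c * b1 = y * b2 + z * b3)" for c
  have "b2 * b1 = b1 * b2 + 0 * b3" by simp
  then have "P b2" unfolding P_def using assms by blast
  then have "P (LEAST c. P c)" by (rule LeastI)
  moreover have "(LEAST c. P c) \<le> c" if "P c" for c
    using that by (rule Least_le)
  ultimately show ?thesis unfolding least_rel_def P_def by blast
qed

text \<open>Otherwise the relation for \<open>c1 * b1\<close> could be substituted into the one for
  \<open>c2 * b2\<close>; cancelling \<open>r12 * b2\<close> would leave a smaller positive multiple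
  of \<open>b2\<close>.\<close>

lemma rel_coeff_less:
  assumes "least_rel b2 b1 b3 c2" "0 < b3" "0 < r12" "0 < r13"
    and c1: "c1 * b1 = r12 * b2 + r13 * b3" and c2: "c2 * b2 = r21 * b1 + r23 * b3"
  shows "r21 < c1"
proof (rule ccontr)
  assume "\<not> r21 < c1"
  then obtain e where "r21 = c1 + e" using le_Suc_ex not_less by blast
  then have eq: "c2 * b2 = e * b1 + r12 * b2 + (r13 + r23) * b3"
    using c1 c2 by (simp add: algebra_simps)
  have "0 < (r13 + r23) * b3" using assms by simp
  then have "r12 * b2 < c2 * b2" using eq by linarith
  then have "r12 < c2" by simp
  then obtain m where m: "c2 = r12 + m" "0 < m" using less_imp_add_positive by blast
  have "m * b2 = e * b1 + (r13 + r23) * b3"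
    using eq unfolding m(1) by (simp add: algebra_simps)
  then have "c2 \<le> m" using least_rel_le[OF assms(1)] m(2) by blast
  then show False using m assms by simp
qed

text \<open>Adding the two relations and cancelling \<open>b1\<close> and \<open>b2\<close> leaves a
  relation for \<open>(r13 + r23) * b3\<close> alone.\<close>

lemma least_rel_le_sum:
  assumes "least_rel b3 b1 b2 c3" "r21 < c1" "r12 < c2" "0 < b1" "0 < b2"
    and c1: "c1 * b1 = r12 * b2 + r13 * b3" and c2: "c2 * b2 = r21 * b1 + r23 * b3"
  shows "c3 \<le> r13 + r23"
proof -
  obtain p q where pq: "c1 = r21 + p" "c2 = r12 + q" "0 < p" "0 < q"
    using less_imp_add_positive[OF assms(2)] less_imp_add_positive[OF assms(3)] by blast
  have eq: "(r13 + r23) * b3 = p * b1 + q * b2"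
    using c1 c2 unfolding pq(1,2) by (simp add: algebra_simps)
  moreover have "0 < p * b1" using pq assms by simp
  ultimately have "0 < r13 + r23" by (cases "r13 + r23") auto
  from least_rel_le[OF assms(1) this eq] show ?thesis .
qed

lemma herzog_of_positive_relations:
  assumes "0 < b1" "0 < b2" "0 < b3" "gcd b1 (gcd b2 b3) = 1"
    and L: "least_rel b1 b2 b3 c1" "least_rel b2 b1 b3 c2" "least_rel b3 b1 b2 c3"
    and c1: "c1 * b1 = r12 * b2 + r13 * b3"
    and c2: "c2 * b2 = r21 * b1 + r23 * b3"
    and c3: "c3 * b3 = r31 * b1 + r32 * b2"
    and pos: "0 < r12" "0 < r13" "0 < r21" "0 < r23" "0 < r31" "0 < r32"
  shows "herzog b1 b2 b3 r21 r32 r13 r31 r12 r23"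
proof -
  note c1' = c1[unfolded add.commute[of "r12 * b2"]]
    and c2' = c2[unfolded add.commute[of "r21 * b1"]]
    and c3' = c3[unfolded add.commute[of "r31 * b1"]]
    and L' = L[THEN least_rel_swap[THEN iffD1]]
  have less: "r21 < c1" "r31 < c1" "r12 < c2" "r32 < c2" "r13 < c3" "r23 < c3"
    using rel_coeff_less[OF L(2) assms(3) pos(1,2) c1 c2]
      rel_coeff_less[OF L(3) assms(2) pos(2,1) c1' c3]
      rel_coeff_less[OF L(1) assms(3) pos(3,4) c2 c1]
      rel_coeff_less[OF L'(3) assms(1) pos(4,3) c2' c3']
      rel_coeff_less[OF L'(1) assms(2) pos(5,6) c3 c1']
      rel_coeff_less[OF L'(2) assms(1) pos(6,5) c3' c2'] by auto
  have le: "c3 \<le> r13 + r23" "c2 \<le> r12 + r32" "c1 \<le> r21 + r31"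
    using least_rel_le_sum[OF L(3) less(1,3) assms(1,2) c1 c2]
      least_rel_le_sum[OF L(2) less(2,5) assms(1,3) c1' c3]
      least_rel_le_sum[OF L(1) less(4,6) assms(2,3) c2' c3'] by auto
  then obtain e1 e2 e3 where e: "r21 + r31 = c1 + e1" "r12 + r32 = c2 + e2" "r13 + r23 = c3 + e3"
    using le_Suc_ex by metis
  \<comment> \<open>The sum of all three relations turns the three inequalities into equalities,
    since every weight is positive.\<close>
  have "(r21 + r31) * b1 + (r12 + r32) * b2 + (r13 + r23) * b3 = c1 * b1 + c2 * b2 + c3 * b3"
    unfolding c1 c2 c3 by (simp add: algebra_simps)
  then have "e1 * b1 + e2 * b2 + e3 * b3 = 0"
    unfolding e by (simp add: algebra_simps)
  then have sums: "c1 = r21 + r31" "c2 = r32 + r12" "c3 = r13 + r23"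
    using e assms(1-3) by auto
  show ?thesis
    by unfold_locales
      (use assms sums L[THEN least_rel_le] in auto)
qed

section \<open>Coinciding least multiples: the symmetric case\<close>

lemma two_term_relation:
  assumes "0 < b1" "0 < b3" and L: "least_rel b1 b2 b3 c1" "least_rel b3 b1 b2 c3"
    and eq: "c1 * b1 = r * b3"
  shows "c1 * b1 = c3 * b3 \<or> c3 * b3 < c1 * b1 \<and> (\<exists>s. c3 * b3 = s * b2)"
proof -
  have "0 < c1 * b1" using least_rel_pos[OF L(1)] assms(1) by simp
  then have "0 < r" unfolding eq by simp
  then have "c3 \<le> r" using least_rel_le[OF L(2), of r c1 0] eq by simp
  show ?thesis
  proof (cases "c3 = r")
    case False
    then obtain m where m: "r = c3 + m" "0 < m"
      using \<open>c3 \<le> r\<close> by (metis le_Suc_ex add_0_right not_gr_zero)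
    obtain x y where xy: "c3 * b3 = x * b1 + y * b2" using least_rel_obtain[OF L(2)] by blast
    have c1: "c1 * b1 = m * b3 + x * b1 + y * b2" using eq m xy by (simp add: algebra_simps)
    have mb: "0 < m * b3" using m assms by simp
    then have "x * b1 < c1 * b1" using c1 by linarith
    then have "x < c1" by simp
    then obtain n where n: "c1 = x + n" "0 < n" using less_imp_add_positive by blast
    have "n * b1 = y * b2 + m * b3" using c1 unfolding n(1) by (simp add: algebra_simps)
    then have "c1 \<le> n" using least_rel_le[OF L(1)] n by blast
    then have "x = 0" using n by simp
    then show ?thesis using xy c1 mb by auto
  qed (use eq in simp)
qed

text \<open>Without a coincidence, \<open>two_term_relation\<close> would apply three times in a row
  and give the strict cycle \<open>c1 * b1 > c3 * b3 > c2 * b2 > c1 * b1\<close>.\<close>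

lemma equal_multiples_of_two_term_relation:
  assumes pos: "0 < b1" "0 < b2" "0 < b3"
    and L: "least_rel b1 b2 b3 c1" "least_rel b2 b1 b3 c2" "least_rel b3 b1 b2 c3"
    and eq: "c1 * b1 = r * b3"
  shows "c1 * b1 = c2 * b2 \<or> c1 * b1 = c3 * b3 \<or> c2 * b2 = c3 * b3"
proof -
  note L' = L[THEN least_rel_swap[THEN iffD1]]
  consider "c1 * b1 = c3 * b3" | s where "c3 * b3 < c1 * b1" "c3 * b3 = s * b2"
    using two_term_relation[OF pos(1,3) L(1,3) eq] by blast
  then show ?thesis
  proof cases
    case 2
    consider "c3 * b3 = c2 * b2" | t where "c2 * b2 < c3 * b3" "c2 * b2 = t * b1"
      using two_term_relation[OF pos(3,2) L(3) L'(2) 2(2)] by blast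
    then show ?thesis
    proof cases
      case t: 2
      then show ?thesis
        using two_term_relation[OF pos(2,1) L'(2) L(1) t(2)] 2(1) by linarith
    qed simp
  qed simp
qed

text \<open>The formula determines \<open>c\<close>, so the semigroup has one pseudo-Frobenius
  number. In \<open>c + b1 = j * b2 + l * b3\<close> neither coefficient can reach its bound, and
  neither can stop more than one short of it.\<close>

lemma PF_unique_of_equal_multiples:
  assumes pos: "0 < b1" "0 < b2" "0 < b3"
    and L: "least_rel b1 b2 b3 c1" "least_rel b2 b1 b3 c2" "least_rel b3 b1 b2 c3"
    and eq: "c1 * b1 = c3 * b3" and c: "c \<in> pseudo_frobenius (nsg3 b1 b2 b3)"
  shows "c + b1 = (c2 - 1) * b2 + (c3 - 1) * b3"
proof -
  let ?H = "nsg3 b1 b2 b3"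
  have cH: "c \<noteq> x * b1 + y * b2 + z * b3" for x y z
    using c nsg3_memI[of c b1 x b2 y b3 z] by (auto simp: pseudo_frobenius_def mult.commute)
  have rep: "\<exists>x y z. c + h = x * b1 + y * b2 + z * b3" if "h \<in> ?H" "h \<noteq> 0" for h
  proof -
    have "c + h \<in> ?H" using c that by (auto simp: pseudo_frobenius_def)
    then show ?thesis unfolding nsg3_def by (auto simp: mult.commute)
  qed
  have cpos: "0 < c1" "0 < c2" "0 < c3" using L[THEN least_rel_pos] .
  obtain i j l where 1: "c + b1 = i * b1 + j * b2 + l * b3"
    using rep[OF nsg3_gens(1)] pos by auto
  have "i = 0"
  proof (cases i)
    case (Suc i')
    then have "c = i' * b1 + j * b2 + l * b3" using 1 by simp
    then show ?thesis using cH by blast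
  qed simp
  note 1 = 1[unfolded this mult_zero_left add_0]
  \<comment> \<open>Otherwise \<open>c3 * b3\<close> could be exchanged for \<open>c1 * b1\<close>,
    and removing one \<open>b1\<close> would represent \<open>c\<close> itself.\<close>
  have lc3: "l < c3"
  proof (rule ccontr)
    assume "\<not> l < c3"
    then obtain e where e: "l = c3 + e" using le_Suc_ex not_less by blast
    obtain c1' where "c1 = Suc c1'" using cpos(1) gr0_conv_Suc by blast
    then have "c = c1' * b1 + j * b2 + e * b3"
      using 1 eq unfolding e by (simp add: algebra_simps)
    then show False using cH by blast
  qed
  have jc2: "j < c2"
  proof (rule ccontr)
    assume "\<not> j < c2"
    then obtain e where e: "j = c2 + e" using le_Suc_ex not_less by blast
    obtain x z where xz: "c2 * b2 = x * b1 + z * b3" using least_rel_obtain[OF L(2)] by blast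
    have c: "c + b1 = x * b1 + e * b2 + (l + z) * b3"
      using 1 xz unfolding e by (simp add: algebra_simps)
    show False
    proof (cases x)
      case 0
      have "0 < c2 * b2" using cpos pos by simp
      then have "0 < z" using xz 0 by (cases z) auto
      then have "c3 \<le> z" using least_rel_le[OF L(3), of z 0 c2] xz 0 by simp
      then obtain z' where z': "z = c3 + z'" using le_Suc_ex by blast
      obtain c1' where "c1 = Suc c1'" using cpos(1) gr0_conv_Suc by blast
      then have "c = c1' * b1 + e * b2 + (l + z') * b3"
        using c eq 0 unfolding z' by (simp add: algebra_simps)
      then show ?thesis using cH by blast
    next
      case (Suc x')
      then have "c = x' * b1 + e * b2 + (l + z) * b3" using c by simp
      then show ?thesis using cH by blast
    qed
  qed
  \<comment> \<open>Comparing \<open>c + b1 + b2\<close> in two ways gives a relation with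
    \<open>Suc j\<close> copies of \<open>b2\<close>; if \<open>b3\<close> is on the wrong side,
    \<open>c1 * b1\<close> is exchanged for \<open>c3 * b3\<close>.\<close>
  have "c2 \<le> Suc j"
  proof -
    obtain i y m where 2: "c + b2 = i * b1 + y * b2 + m * b3"
      using rep[OF nsg3_gens(2)] pos by auto
    have "y = 0"
    proof (cases y)
      case (Suc y')
      then have "c = i * b1 + y' * b2 + m * b3" using 2 by simp
      then show ?thesis using cH by blast
    qed simp
    have 12: "Suc j * b2 + l * b3 = Suc i * b1 + m * b3"
      using 1 2 \<open>y = 0\<close> by simp
    show ?thesis
    proof (cases "l \<le> m")
      case True
      then obtain e where "m = l + e" using le_Suc_ex by blast
      then have "Suc j * b2 = Suc i * b1 + e * b3" using 12 by (simp add: algebra_simps)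
      then show ?thesis using least_rel_le[OF L(2)] by blast
    next
      case False
      then obtain e where e: "l = m + e" using le_Suc_ex by (metis nle_le)
      then have i1: "Suc i * b1 = Suc j * b2 + e * b3" using 12 by (simp add: algebra_simps)
      then have "c1 \<le> Suc i" using least_rel_le[OF L(1)] by blast
      then obtain p where p: "Suc i = c1 + p" using le_Suc_ex by blast
      obtain q where q: "c3 = e + q" using lc3 e by (metis le_Suc_ex add_leE less_imp_le)
      have "Suc j * b2 = p * b1 + q * b3"
        using i1 eq unfolding p q by (simp add: algebra_simps)
      then show ?thesis using least_rel_le[OF L(2)] by blast
    qed
  qed
  moreover have "c3 \<le> Suc l"
  proof (rule ccontr)
    assume nl: "\<not> c3 \<le> Suc l"
    obtain i n z where 3: "c + b3 = i * b1 + n * b2 + z * b3"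
      using rep[OF nsg3_gens(3)] pos by auto
    have "z = 0"
    proof (cases z)
      case (Suc z')
      then have "c = i * b1 + n * b2 + z' * b3" using 3 by simp
      then show ?thesis using cH by blast
    qed simp
    have 13: "j * b2 + Suc l * b3 = Suc i * b1 + n * b2"
      using 1 3 \<open>z = 0\<close> by simp
    have "n \<le> j"
    proof (rule ccontr)
      assume "\<not> n \<le> j"
      then obtain e where "n = j + e" using le_Suc_ex by (metis nle_le)
      then have "Suc l * b3 = Suc i * b1 + e * b2" using 13 by (simp add: algebra_simps)
      then have "c3 \<le> Suc l" using least_rel_le[OF L(3)] by blast
      then show False using nl by simp
    qed
    then obtain e where e: "j = n + e" using le_Suc_ex by blast
    then have i1: "Suc i * b1 = e * b2 + Suc l * b3" using 13 by (simp add: algebra_simps)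
    then have "c1 \<le> Suc i" using least_rel_le[OF L(1)] by blast
    moreover have "i < c1"
    proof (rule ccontr)
      assume "\<not> i < c1"
      then obtain p where p: "i = c1 + p" using le_Suc_ex not_less by blast
      obtain c3' where "c3 = Suc c3'" using cpos(3) gr0_conv_Suc by blast
      then have "c = p * b1 + n * b2 + c3' * b3"
        using 3 eq \<open>z = 0\<close> unfolding p by (simp add: algebra_simps)
      then show False using cH by blast
    qed
    ultimately have "Suc i = c1" by simp
    obtain q where q: "c3 = Suc l + q" "0 < q"
      using nl less_imp_add_positive not_le by blast
    \<comment> \<open>All copies of \<open>b1\<close> cancel against \<open>c3 * b3\<close>, so a
      multiple of \<open>b2\<close> at most \<open>j * b2\<close> is a multiple of
      \<open>b3\<close>, against \<open>j < c2\<close>.\<close>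
    have e2: "e * b2 = q * b3"
      using i1 eq \<open>Suc i = c1\<close> unfolding q(1) by (simp add: algebra_simps)
    have "0 < q * b3" using q pos by simp
    then have "0 < e" using e2 by (cases e) auto
    then have "c2 \<le> e" using least_rel_le[OF L(2), of e 0 q] e2 by simp
    then show False using e jc2 by simp
  qed
  ultimately have "j = c2 - 1" "l = c3 - 1" using jc2 lc3 by auto
  then show ?thesis using 1 by simp
qed

lemma not_2AGL_of_equal_multiples:
  assumes mg: "min_gen3 b1 b2 b3"
    and L: "least_rel b1 b2 b3 c1" "least_rel b2 b1 b3 c2" "least_rel b3 b1 b2 c3"
    and eq: "c1 * b1 = c3 * b3"
  shows "\<not> is_2AGL (nsg3 b1 b2 b3) (k :: 'k::field itself)"
proof -
  let ?H = "nsg3 b1 b2 b3"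
  interpret numerical_semigroup ?H using mg by (rule numerical_semigroup_nsg3)
  have pos: "0 < b1" "0 < b2" "0 < b3" using mg by (auto simp: min_gen3_def)
  have "c = frobenius ?H" if "c \<in> pseudo_frobenius ?H" for c
    using PF_unique_of_equal_multiples[OF pos L eq that]
      PF_unique_of_equal_multiples[OF pos L eq frobenius_PF] by simp
  then have "pseudo_frobenius ?H = {frobenius ?H}" using frobenius_PF by blast
  then have "canon_set ?H = ?H" by (auto simp: canon_set_def)
  moreover have "add_hull ?H = ?H" by (rule add_hull_closed) (rule add_mem)
  ultimately show ?thesis unfolding is_2AGL_iff by simp
qed

text \<open>A zero coefficient in a least relation makes two least multiples coincide, and then
  \<open>S = K\<close>; so all six coefficients are positive and form the matrix exponents.\<close>

lemma herzog_of_2AGL: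
  assumes mg: "min_gen3 b1 b2 b3" and agl: "is_2AGL (nsg3 b1 b2 b3) (k :: 'k::field itself)"
  shows "\<exists>\<alpha> \<beta> \<gamma> \<alpha>' \<beta>' \<gamma>'. herzog b1 b2 b3 \<alpha> \<beta> \<gamma> \<alpha>' \<beta>' \<gamma>'"
proof -
  have pos: "0 < b1" "0 < b2" "0 < b3" and gcd: "gcd b1 (gcd b2 b3) = 1"
    using mg by (auto simp: min_gen3_def)
  obtain c1 c2 c3 where L: "least_rel b1 b2 b3 c1" "least_rel b2 b1 b3 c2" "least_rel b3 b1 b2 c3"
    using least_rel_exists pos by metis
  note L' = L[THEN least_rel_swap[THEN iffD1]]
  obtain r12 r13 r21 r23 r31 r32 where r: "c1 * b1 = r12 * b2 + r13 * b3"
    "c2 * b2 = r21 * b1 + r23 * b3" "c3 * b3 = r31 * b1 + r32 * b2"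
    using L[THEN least_rel_obtain] by blast
  have "\<not> (c1 * b1 = c2 * b2 \<or> c1 * b1 = c3 * b3 \<or> c2 * b2 = c3 * b3)"
  proof
    assume "c1 * b1 = c2 * b2 \<or> c1 * b1 = c3 * b3 \<or> c2 * b2 = c3 * b3"
    then consider "c1 * b1 = c2 * b2" | "c1 * b1 = c3 * b3" | "c2 * b2 = c3 * b3" by blast
    then show False
    proof cases
      case 1
      have "min_gen3 b1 b3 b2" using mg min_gen3_swap23 by blast
      from not_2AGL_of_equal_multiples[OF this L'(1) L(3,2) 1, where k = k] agl show ?thesis
        unfolding nsg3_swap23[of b1 b3] by blast
    next
      case 2
      from not_2AGL_of_equal_multiples[OF mg L 2, where k = k] agl show ?thesis by blast
    next
      case 3
      have "min_gen3 b2 b1 b3" using mg min_gen3_swap12 by blast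
      from not_2AGL_of_equal_multiples[OF this L(2,1) L'(3) 3, where k = k] agl show ?thesis
        unfolding nsg3_swap12[of b2 b1] by blast
    qed
  qed
  note neq = this
  have "0 < r12" "0 < r13" "0 < r21" "0 < r23" "0 < r31" "0 < r32"
  proof -
    show "0 < r12"
      using equal_multiples_of_two_term_relation[OF pos L, of r13] neq r(1) by (cases r12) auto
    show "0 < r13"
      using equal_multiples_of_two_term_relation[OF pos(1,3,2) L'(1) L(3,2), of r12] neq r(1)
      by (cases r13) auto
    show "0 < r21"
      using equal_multiples_of_two_term_relation[OF pos(2,1,3) L(2,1) L'(3), of r23] neq r(2)
      by (cases r21) auto
    show "0 < r23"
      using equal_multiples_of_two_term_relation[OF pos(2,3,1) L'(2,3) L(1), of r21] neq r(2)
      by (cases r23) auto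
    show "0 < r31"
      using equal_multiples_of_two_term_relation[OF pos(3,1,2) L(3) L'(1,2), of r32] neq r(3)
      by (cases r31) auto
    show "0 < r32"
      using equal_multiples_of_two_term_relation[OF pos(3,2,1) L'(3,2,1), of r31] neq r(3)
      by (cases r32) auto
  qed
  then show ?thesis
    using herzog_of_positive_relations[OF pos gcd L r] by blast
qed

section \<open>The defining ideal\<close>

lemma is_submodule_sum:
  "is_submodule R M \<Longrightarrow> (\<And>i. i \<in> I \<Longrightarrow> f i \<in> M) \<Longrightarrow> sum f I \<in> M"
  by (induction I rule: infinite_finite_induct) (auto simp: is_submodule_def)

lemma ideal_genI: "finite F \<Longrightarrow> F \<subseteq> G \<Longrightarrow> (\<Sum>g\<in>F. c g * g) \<in> ideal_gen G"
  unfolding ideal_gen_def by blast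

lemma is_submodule_ideal_gen: "is_submodule UNIV (ideal_gen G)"
  unfolding is_submodule_def
proof (intro conjI ballI)
  show "0 \<in> ideal_gen G" using ideal_genI[of "{}" G "\<lambda>_. 0"] by simp
next
  fix x y assume "x \<in> ideal_gen G" "y \<in> ideal_gen G"
  then obtain F c F' c' where F: "finite F" "F \<subseteq> G" "x = (\<Sum>g\<in>F. c g * g)"
    and F': "finite F'" "F' \<subseteq> G" "y = (\<Sum>g\<in>F'. c' g * g)"
    unfolding ideal_gen_def by blast
  \<comment> \<open>Both coefficient families are extended by 0 to the union of their finite index
    sets.\<close>
  let ?e = "\<lambda>g. (if g \<in> F then c g else 0) + (if g \<in> F' then c' g else 0)"
  have "x = (\<Sum>g\<in>F \<union> F'. (if g \<in> F then c g else 0) * g)"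
    unfolding F(3) using F(1) F'(1) by (intro sum.mono_neutral_cong_left) auto
  moreover have "y = (\<Sum>g\<in>F \<union> F'. (if g \<in> F' then c' g else 0) * g)"
    unfolding F'(3) using F(1) F'(1) by (intro sum.mono_neutral_cong_left) auto
  ultimately have "x + y = (\<Sum>g\<in>F \<union> F'. ?e g * g)"
    by (simp only: sum.distrib distrib_right)
  moreover have "finite (F \<union> F')" "F \<union> F' \<subseteq> G" using F F' by auto
  ultimately show "x + y \<in> ideal_gen G"
    using ideal_genI[of "F \<union> F'" G ?e] by simp
next
  fix r x assume "x \<in> ideal_gen G"
  then obtain F c where F: "finite F" "F \<subseteq> G" "x = (\<Sum>g\<in>F. c g * g)"
    unfolding ideal_gen_def by blast
  have "r * x = (\<Sum>g\<in>F. (r * c g) * g)"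
    unfolding F(3) by (simp add: sum_distrib_left mult.assoc)
  then show "r * x \<in> ideal_gen G"
    using ideal_genI[OF F(1,2)] by simp
qed

lemma ideal_gen_superset: "g \<in> G \<Longrightarrow> g \<in> ideal_gen G"
  using ideal_genI[of "{g}" G "\<lambda>_. 1"] by simp

lemma ideal_gen_subset: "is_submodule UNIV I \<Longrightarrow> G \<subseteq> I \<Longrightarrow> ideal_gen G \<subseteq> I"
  unfolding ideal_gen_def by (auto intro!: is_submodule_sum) (auto simp: is_submodule_def)

lemma is_submodule_uminus:
  fixes I :: "'a::comm_ring_1 set"
  shows "is_submodule UNIV I \<Longrightarrow> x \<in> I \<Longrightarrow> - x \<in> I"
  unfolding is_submodule_def by (metis UNIV_I mult_minus1)

section \<open>Monomials and the evaluation map\<close>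

definition mono3 :: "nat \<times> nat \<times> nat \<Rightarrow> 'k::field poly3" where
  "mono3 m = Poly_Mapping.single m 1"

lemma mono3_mult: "mono3 m * mono3 n = mono3 (m + n)"
  by (simp add: mono3_def mult_single)

lemma var_power:
  "varX ^ n = mono3 (n, 0, 0)" "varY ^ n = mono3 (0, n, 0)" "varZ ^ n = mono3 (0, 0, n)"
proof -
  have "varX ^ n = (mono3 (n, 0, 0) :: 'k::field poly3)"
    by (induction n) (simp_all add: varX_def mono3_def mult_single single_one[symmetric] zero_prod_def)
  moreover have "varY ^ n = (mono3 (0, n, 0) :: 'k::field poly3)"
    by (induction n) (simp_all add: varY_def mono3_def mult_single single_one[symmetric] zero_prod_def)
  moreover have "varZ ^ n = (mono3 (0, 0, n) :: 'k::field poly3)"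
    by (induction n) (simp_all add: varZ_def mono3_def mult_single single_one[symmetric] zero_prod_def)
  ultimately show
    "varX ^ n = (mono3 (n, 0, 0) :: 'k::field poly3)"
    "varY ^ n = (mono3 (0, n, 0) :: 'k::field poly3)"
    "varZ ^ n = (mono3 (0, 0, n) :: 'k::field poly3)" by blast+
qed

lemma poly_mapping_eq_sum:
  "p = (\<Sum>m\<in>Poly_Mapping.keys p. Poly_Mapping.single m (Poly_Mapping.lookup p m))"
  by (rule poly_mapping_eqI)
    (auto simp: lookup_sum lookup_single when_def in_keys_iff)

lemma deg3_add: "deg3 b1 b2 b3 (m + n) = deg3 b1 b2 b3 m + deg3 b1 b2 b3 n"
  by (cases m; cases n) (simp add: algebra_simps)

lemma eval3_superset:
  assumes "finite A" "Poly_Mapping.keys p \<subseteq> A"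
  shows "eval3 b1 b2 b3 p = (\<Sum>m\<in>A. monom (Poly_Mapping.lookup p m) (deg3 b1 b2 b3 m))"
  unfolding eval3_def deg3_def using assms
  by (intro sum.mono_neutral_cong_left) (auto simp: in_keys_iff split: prod.splits)

lemma eval3_0: "eval3 b1 b2 b3 0 = 0"
  by (simp add: eval3_def)

lemma eval3_single: "eval3 b1 b2 b3 (Poly_Mapping.single m c) = monom c (deg3 b1 b2 b3 m)"
  by (subst eval3_superset[of "{m}"]) auto

lemma eval3_add: "eval3 b1 b2 b3 (p + q) = eval3 b1 b2 b3 p + eval3 b1 b2 b3 q"
proof -
  let ?A = "Poly_Mapping.keys p \<union> Poly_Mapping.keys q"
  have "finite ?A" "Poly_Mapping.keys (p + q) \<subseteq> ?A"
    using keys_add[of p q] by auto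
  then show ?thesis
    using eval3_superset[of ?A p] eval3_superset[of ?A q] eval3_superset[of ?A "p + q"]
    by (simp add: lookup_add add_monom[symmetric] sum.distrib)
qed

lemma eval3_sum: "eval3 b1 b2 b3 (sum f A) = (\<Sum>x\<in>A. eval3 b1 b2 b3 (f x))"
  by (induction A rule: infinite_finite_induct) (auto simp: eval3_0 eval3_add)

lemma eval3_mult: "eval3 b1 b2 b3 (p * q) = eval3 b1 b2 b3 p * eval3 b1 b2 b3 q"
proof -
  let ?s = "\<lambda>p m. Poly_Mapping.single m (Poly_Mapping.lookup p m)"
  have "eval3 b1 b2 b3 (?s p m * ?s q n) = eval3 b1 b2 b3 (?s p m) * eval3 b1 b2 b3 (?s q n)" for m n
    by (simp add: mult_single eval3_single deg3_add mult_monom)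
  then have "eval3 b1 b2 b3 ((\<Sum>m\<in>Poly_Mapping.keys p. ?s p m) * (\<Sum>n\<in>Poly_Mapping.keys q. ?s q n)) =
    eval3 b1 b2 b3 (\<Sum>m\<in>Poly_Mapping.keys p. ?s p m) * eval3 b1 b2 b3 (\<Sum>n\<in>Poly_Mapping.keys q. ?s q n)"
    by (simp add: sum_product eval3_sum)
  then show ?thesis
    by (simp only: poly_mapping_eq_sum[symmetric])
qed

lemma is_submodule_def_ideal: "is_submodule UNIV (def_ideal b1 b2 b3)"
  unfolding is_submodule_def def_ideal_def by (auto simp: eval3_0 eval3_add eval3_mult)

lemma binomial_in_def_ideal_iff:
  "mono3 m - mono3 n \<in> (def_ideal b1 b2 b3 :: 'k::field poly3 set) \<longleftrightarrow>
    deg3 b1 b2 b3 m = deg3 b1 b2 b3 n"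
proof -
  have "mono3 m - mono3 n = Poly_Mapping.single m 1 + (Poly_Mapping.single n (- 1) :: 'k poly3)"
    by (simp add: mono3_def single_uminus)
  then have "eval3 b1 b2 b3 (mono3 m - mono3 n :: 'k poly3) =
      monom 1 (deg3 b1 b2 b3 m) - monom 1 (deg3 b1 b2 b3 n)"
    by (simp add: eval3_add eval3_single minus_monom[symmetric])
  then show ?thesis
    unfolding def_ideal_def by (auto simp: monom_eq_iff')
qed

text \<open>The reduction of \<open>p\<close> to \<open>\<Sum>\<^sub>m p\<^sub>m \<rho>(m)\<close> collects terms of equal degree, so it vanishes
  for \<open>p\<close> in the defining ideal.\<close>

lemma def_ideal_subset_of_binomials:
  fixes I :: "'k::field poly3 set"
  assumes I: "is_submodule UNIV I"
    and red: "\<And>m. mono3 m - mono3 (\<rho> m) \<in> I"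
    and \<rho>: "\<And>m n. \<rho> m = \<rho> n \<longleftrightarrow> deg3 b1 b2 b3 m = deg3 b1 b2 b3 n"
  shows "def_ideal b1 b2 b3 \<subseteq> I"
proof
  fix p :: "'k poly3" assume "p \<in> def_ideal b1 b2 b3"
  then have p0: "eval3 b1 b2 b3 p = 0" by (simp add: def_ideal_def)
  let ?K = "Poly_Mapping.keys p" and ?c = "Poly_Mapping.lookup p"
  have coeff0: "(\<Sum>m\<in>?K. if deg3 b1 b2 b3 m = e then ?c m else 0) = 0" for e
  proof -
    have "coeff (eval3 b1 b2 b3 p) e = (\<Sum>m\<in>?K. if deg3 b1 b2 b3 m = e then ?c m else 0)"
      unfolding eval3_superset[OF finite_keys order_refl] coeff_sum coeff_monom ..
    then show ?thesis using p0 by simp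
  qed
  have "(\<Sum>m\<in>?K. Poly_Mapping.single (\<rho> m) (?c m)) = 0"
  proof (rule poly_mapping_eqI)
    fix n
    have eq: "Poly_Mapping.lookup (\<Sum>m\<in>?K. Poly_Mapping.single (\<rho> m) (?c m)) n =
        (\<Sum>m\<in>?K. if \<rho> m = n then ?c m else 0)"
      by (simp add: lookup_sum lookup_single when_def)
    also have "\<dots> = 0"
    proof (cases "\<exists>m0. n = \<rho> m0")
      case True
      then obtain m0 where n: "n = \<rho> m0" by blast
      show ?thesis unfolding n \<rho> by (rule coeff0)
    next
      case False
      then show ?thesis by (intro sum.neutral) auto
    qed
    finally show "Poly_Mapping.lookup (\<Sum>m\<in>?K. Poly_Mapping.single (\<rho> m) (?c m)) n = Poly_Mapping.lookup 0 n"
      by simp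
  qed
  moreover have "p = (\<Sum>m\<in>?K. Poly_Mapping.single m (?c m))"
    by (rule poly_mapping_eq_sum)
  ultimately have "p = (\<Sum>m\<in>?K. Poly_Mapping.single m (?c m) - Poly_Mapping.single (\<rho> m) (?c m))"
    by (simp add: sum_subtractf)
  also have "\<dots> = (\<Sum>m\<in>?K. Poly_Mapping.single 0 (?c m) * (mono3 m - mono3 (\<rho> m)))"
    by (simp add: mono3_def right_diff_distrib mult_single)
  also have "\<dots> \<in> I"
    using I red by (intro is_submodule_sum[OF I]) (auto simp: is_submodule_def)
  finally show "p \<in> I" .
qed

text \<open>A set of exponents closed under multiplication by monomials defines a monomial
  ideal.\<close>

lemma is_submodule_keys_subset:
  assumes "\<And>m n. n \<in> U \<Longrightarrow> m + n \<in> U"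
  shows "is_submodule UNIV {p :: 'k::field poly3. Poly_Mapping.keys p \<subseteq> U}"
  unfolding is_submodule_def
proof (intro conjI ballI)
  fix p q :: "'k poly3" assume q: "q \<in> {p. Poly_Mapping.keys p \<subseteq> U}"
  then have "{m + n | m n. m \<in> Poly_Mapping.keys p \<and> n \<in> Poly_Mapping.keys q} \<subseteq> U"
    using assms by blast
  then show "p * q \<in> {p. Poly_Mapping.keys p \<subseteq> U}"
    using keys_mult[of p q] by blast
  assume "p \<in> {p. Poly_Mapping.keys p \<subseteq> U}"
  with q show "p + q \<in> {p. Poly_Mapping.keys p \<subseteq> U}"
    using keys_add[of p q] by auto
qed simp

section \<open>The ideal of minors\<close>

definition herzog_matrix ::
  "nat \<Rightarrow> nat \<Rightarrow> nat \<Rightarrow> nat \<Rightarrow> nat \<Rightarrow> nat \<Rightarrow> nat \<Rightarrow> nat \<Rightarrow> 'k::field poly3" where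
  "herzog_matrix \<alpha> \<beta> \<gamma> \<alpha>' \<beta>' \<gamma>' =
    mat23 [varX ^ \<alpha>, varY ^ \<beta>, varZ ^ \<gamma>] [varY ^ \<beta>', varZ ^ \<gamma>', varX ^ \<alpha>']"

lemma I2_herzog_matrix:
  "I2 (herzog_matrix \<alpha> \<beta> \<gamma> \<alpha>' \<beta>' \<gamma>' :: nat \<Rightarrow> nat \<Rightarrow> 'k::field poly3) = ideal_gen
    {mono3 (\<alpha>, 0, \<gamma>') - mono3 (0, \<beta> + \<beta>', 0), mono3 (\<alpha> + \<alpha>', 0, 0) - mono3 (0, \<beta>', \<gamma>),
     mono3 (\<alpha>', \<beta>, 0) - mono3 (0, 0, \<gamma> + \<gamma>')}"
proof -
  have ij: "i < j \<and> j < 3 \<longleftrightarrow> (i, j) \<in> {(0, 1), (0, 2), (1, 2)}" for i j :: nat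
    by auto
  have eq: "{M 0 i * M 1 j - M 0 j * M 1 i | i j. i < j \<and> j < 3} =
    {M 0 0 * M 1 1 - M 0 1 * M 1 0, M 0 0 * M 1 2 - M 0 2 * M 1 0, M 0 1 * M 1 2 - M 0 2 * M 1 1}"
    for M :: "nat \<Rightarrow> nat \<Rightarrow> 'k poly3"
    unfolding ij by auto
  show ?thesis
    unfolding I2_def eq herzog_matrix_def
    by (simp add: mat23_def var_power mono3_mult add.commute)
qed

text \<open>This reads minimality off the generators: if all their terms lie in a monomial ideal, so
  do the terms of every element, and \<open>m\<close> survives in the binomial because
  \<open>m \<noteq> n\<close>.\<close>

lemma binomial_keys:
  fixes I :: "'k::field poly3 set"
  assumes I: "I = ideal_gen G"
    and G: "\<And>g. g \<in> G \<Longrightarrow> \<exists>m n. g = mono3 m - mono3 n \<and> m \<in> U \<and> n \<in> U"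
    and U: "\<And>m n. n \<in> U \<Longrightarrow> m + n \<in> U"
    and "mono3 m - mono3 n \<in> I" "m \<noteq> n"
  shows "m \<in> U"
proof -
  have "G \<subseteq> {p. Poly_Mapping.keys p \<subseteq> U}"
  proof
    fix g assume "g \<in> G"
    then obtain m n where "g = mono3 m - mono3 n" "m \<in> U" "n \<in> U" using G by blast
    then show "g \<in> {p. Poly_Mapping.keys p \<subseteq> U}"
      using keys_diff[of "mono3 m :: 'k poly3" "mono3 n"] by (auto simp: mono3_def)
  qed
  then have "I \<subseteq> {p. Poly_Mapping.keys p \<subseteq> U}"
    unfolding I by (intro ideal_gen_subset is_submodule_keys_subset U)
  then have "Poly_Mapping.keys (mono3 m - mono3 n :: 'k poly3) \<subseteq> U"
    using assms(4) by blast
  moreover have "m \<in> Poly_Mapping.keys (mono3 m - mono3 n :: 'k poly3)"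
    using assms(5) by (simp add: mono3_def in_keys_iff lookup_minus lookup_single when_def)
  ultimately show ?thesis by blast
qed

text \<open>The relations are the degrees of the minors. A relation for \<open>c * b1\<close> puts a
  binomial with term \<open>X^c\<close> into the ideal, and the smallest pure power of X among the
  terms of the minors bounds \<open>c\<close>; the same holds for Y and Z.\<close>

lemma herzog_of_def_ideal_eq:
  assumes mg: "min_gen3 b1 b2 b3"
    and pos: "0 < \<alpha>" "0 < \<beta>" "0 < \<gamma>" "0 < \<alpha>'" "0 < \<beta>'" "0 < \<gamma>'"
    and eq: "(def_ideal b1 b2 b3 :: 'k::field poly3 set) = I2 (herzog_matrix \<alpha> \<beta> \<gamma> \<alpha>' \<beta>' \<gamma>')"
  shows "herzog b1 b2 b3 \<alpha> \<beta> \<gamma> \<alpha>' \<beta>' \<gamma>'"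
proof -
  define G where "G = {mono3 (\<alpha>, 0, \<gamma>') - mono3 (0, \<beta> + \<beta>', 0),
    mono3 (\<alpha> + \<alpha>', 0, 0) - mono3 (0, \<beta>', \<gamma>),
    mono3 (\<alpha>', \<beta>, 0) - mono3 (0, 0, \<gamma> + \<gamma>') :: 'k poly3}"
  have I: "def_ideal b1 b2 b3 = ideal_gen G"
    unfolding eq I2_herzog_matrix G_def ..
  then have "G \<subseteq> def_ideal b1 b2 b3" using ideal_gen_superset by blast
  then have deg: "b1 * \<alpha> + b3 * \<gamma>' = b2 * (\<beta> + \<beta>')" "b1 * (\<alpha> + \<alpha>') = b2 * \<beta>' + b3 * \<gamma>"
    "b1 * \<alpha>' + b2 * \<beta> = b3 * (\<gamma> + \<gamma>')"
    unfolding G_def by (simp_all add: binomial_in_def_ideal_iff)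
  have key: "m \<in> U"
    if "\<And>m n. n \<in> U \<Longrightarrow> m + n \<in> U" "deg3 b1 b2 b3 m = deg3 b1 b2 b3 n" "m \<noteq> n"
      "{(\<alpha>, 0, \<gamma>'), (0, \<beta> + \<beta>', 0), (\<alpha> + \<alpha>', 0, 0), (0, \<beta>', \<gamma>), (\<alpha>', \<beta>, 0), (0, 0, \<gamma> + \<gamma>')} \<subseteq> U"
    for U m n
  proof (rule binomial_keys[OF I _ that(1) _ that(3)])
    show "mono3 m - mono3 n \<in> (def_ideal b1 b2 b3 :: 'k poly3 set)"
      using that(2) by (simp add: binomial_in_def_ideal_iff)
    show "\<exists>m n. g = mono3 m - mono3 n \<and> m \<in> U \<and> n \<in> U" if "g \<in> G" for g
      using that \<open>_ \<subseteq> U\<close> unfolding G_def by blast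
  qed
  show ?thesis
  proof
    show "\<alpha> + \<alpha>' \<le> c" if "0 < c" "c * b1 = y * b2 + z * b3" for c y z
    proof -
      \<comment> \<open>The set omits exactly the pure powers of X below
        \<open>\<alpha> + \<alpha>'\<close>.\<close>
      have "(c, 0 :: nat, 0 :: nat) \<in> {(i, j, l). \<alpha> + \<alpha>' \<le> i \<or> 0 < j \<or> 0 < l}"
        by (rule key[where n = "(0, y, z)"]) (use that pos in \<open>auto simp: mult.commute\<close>)
      then show ?thesis by simp
    qed
    show "\<beta> + \<beta>' \<le> c" if "0 < c" "c * b2 = x * b1 + z * b3" for c x z
    proof -
      have "(0 :: nat, c, 0 :: nat) \<in> {(i, j, l). \<beta> + \<beta>' \<le> j \<or> 0 < i \<or> 0 < l}"
        by (rule key[where n = "(x, 0, z)"]) (use that pos in \<open>auto simp: mult.commute\<close>)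
      then show ?thesis by simp
    qed
    show "\<gamma> + \<gamma>' \<le> c" if "0 < c" "c * b3 = x * b1 + y * b2" for c x y
    proof -
      have "(0 :: nat, 0 :: nat, c) \<in> {(i, j, l). \<gamma> + \<gamma>' \<le> l \<or> 0 < i \<or> 0 < j}"
        by (rule key[where n = "(x, y, 0)"]) (use that pos in \<open>auto simp: mult.commute\<close>)
      then show ?thesis by simp
    qed
    show "(\<alpha> + \<alpha>') * b1 = \<beta>' * b2 + \<gamma> * b3" "(\<beta> + \<beta>') * b2 = \<alpha> * b1 + \<gamma>' * b3"
      "(\<gamma> + \<gamma>') * b3 = \<alpha>' * b1 + \<beta> * b2"
      using deg by (simp_all only: mult.commute)
    show "gcd b1 (gcd b2 b3) = 1" "0 < b1" "0 < b2" "0 < b3"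
      using mg by (simp_all only: min_gen3_def)
  qed (fact pos)+
qed

context herzog
begin

text \<open>Reducing modulo the minors leads to box monomials times powers of X, and those are
  determined by their degree; this supplies the map \<open>\<rho>\<close> of
  \<open>def_ideal_subset_of_binomials\<close>.\<close>

lemma def_ideal_eq:
  "(def_ideal b1 b2 b3 :: 'k::field poly3 set) = I2 (herzog_matrix \<alpha> \<beta> \<gamma> \<alpha>' \<beta>' \<gamma>')"
    (is "_ = ?I")
proof
  have I: "is_submodule UNIV ?I" by (simp add: I2_def is_submodule_ideal_gen)
  have gens: "mono3 (\<alpha>, 0, \<gamma>') - mono3 (0, \<beta> + \<beta>', 0) \<in> ?I"
    "mono3 (\<alpha> + \<alpha>', 0, 0) - mono3 (0, \<beta>', \<gamma>) \<in> ?I"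
    "mono3 (\<alpha>', \<beta>, 0) - mono3 (0, 0, \<gamma> + \<gamma>') \<in> ?I"
    unfolding I2_herzog_matrix by (auto intro: ideal_gen_superset)
  define R where "R m n \<longleftrightarrow> mono3 m - mono3 n \<in> ?I \<and> deg m = deg n" for m n
  have shift: "mono3 (n + s) - mono3 (m + s) \<in> ?I" if "mono3 m - mono3 n \<in> ?I" for m n s
  proof -
    have "- (mono3 s * (mono3 m - mono3 n)) \<in> ?I"
      using I that by (intro is_submodule_uminus[OF I]) (auto simp: is_submodule_def)
    also have "- (mono3 s * (mono3 m - mono3 n)) = (mono3 (n + s) - mono3 (m + s) :: 'k poly3)"
      by (simp add: right_diff_distrib mono3_mult add.commute)
    finally show ?thesis .
  qed
  have "\<exists>i' j' l'. R (i, j, l) (i', j', l') \<and> box j' l'" for i j l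
  proof (rule normal_form)
    show "R m m" for m using I by (simp add: R_def is_submodule_def)
    show "R m p" if "R m n" "R n p" for m n p
    proof -
      have "(mono3 m - mono3 n) + (mono3 n - mono3 p) \<in> ?I"
        using I that unfolding R_def is_submodule_def by blast
      then show ?thesis using that by (simp add: R_def)
    qed
    show "R (i, j + \<beta>', l + \<gamma>) (i + (\<alpha> + \<alpha>'), j, l)" for i j l
      using shift[OF gens(2), of "(i, j, l)"] deg_step(1)[of i j l] by (simp add: R_def add.commute)
    show "R (i, j + (\<beta> + \<beta>'), l) (i + \<alpha>, j, l + \<gamma>')" for i j l
      using shift[OF gens(1), of "(i, j, l)"] deg_step(2)[of i j l] by (simp add: R_def add.commute)
    show "R (i, j, l + (\<gamma> + \<gamma>')) (i + \<alpha>', j + \<beta>, l)" for i j l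
      using shift[OF gens(3), of "(i, j, l)"] deg_step(3)[of i j l] by (simp add: R_def add.commute)
  qed
  then have "\<exists>n. R m n \<and> box (fst (snd n)) (snd (snd n))" for m
    by (cases m) fastforce
  then obtain \<rho> where \<rho>: "\<And>m. R m (\<rho> m)" "\<And>m. box (fst (snd (\<rho> m))) (snd (snd (\<rho> m)))"
    by metis
  \<comment> \<open>\<open>box_unique\<close> needs the power of X on one side only, hence the
    ordering of the first components.\<close>
  have "m = n" if "box (fst (snd m)) (snd (snd m))" "box (fst (snd n)) (snd (snd n))" "deg m = deg n"
    and le: "fst m \<le> fst n" for m n
  proof -
    obtain i j l e y z where mn: "m = (i, j, l)" "n = (i + e, y, z)"
      using le by (metis le_Suc_ex prod.collapse)
    have "j * b2 + l * b3 = e * b1 + y * b2 + z * b3"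
      using that(3) unfolding mn by (simp add: algebra_simps)
    then show ?thesis using box_unique[of j l e y z] that(1) mn by simp
  qed
  then have uniq: "\<rho> m = \<rho> n" if "deg m = deg n" for m n
    using \<rho> that unfolding R_def by (metis nle_le)
  show "def_ideal b1 b2 b3 \<subseteq> ?I"
  proof (rule def_ideal_subset_of_binomials[OF I])
    show "mono3 m - mono3 (\<rho> m) \<in> ?I" for m using \<rho>(1) by (simp add: R_def)
    show "\<rho> m = \<rho> n \<longleftrightarrow> deg3 b1 b2 b3 m = deg3 b1 b2 b3 n" for m n
      using uniq \<rho>(1) unfolding R_def by metis
  qed
  show "?I \<subseteq> def_ideal b1 b2 b3"
    unfolding I2_herzog_matrix
    using rel1 rel2 rel3
    by (intro ideal_gen_subset is_submodule_def_ideal)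
      (simp add: binomial_in_def_ideal_iff mult.commute)
qed

text \<open>Equal row degrees would make \<open>\<beta> * b2\<close> a multiple of
  \<open>b3\<close>, against the minimality of \<open>\<beta> + \<beta>'\<close>.\<close>

lemma row_degrees_neq: "\<alpha> * b1 \<noteq> \<beta>' * b2"
proof
  assume "\<alpha> * b1 = \<beta>' * b2"
  then have "\<beta> * b2 = 0 * b1 + \<gamma>' * b3" using rel2 by (simp add: algebra_simps)
  then show False using min2[of \<beta>] pos by fastforce
qed

text \<open>The row of smaller degree is placed first, by \<open>transpose\<close> if
  necessary.\<close>

lemma obtain_shift:
  obtains d where "herzog_shift b1 b2 b3 \<alpha> \<beta> \<gamma> \<alpha>' \<beta>' \<gamma>' d"
  | d where "herzog_shift b1 b3 b2 \<alpha>' \<gamma>' \<beta>' \<alpha> \<gamma> \<beta> d"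
proof (cases "\<alpha> * b1 < \<beta>' * b2")
  case True
  then obtain d where "0 < d" "\<alpha> * b1 + d = \<beta>' * b2" using less_imp_add_positive by blast
  then have "herzog_shift b1 b2 b3 \<alpha> \<beta> \<gamma> \<alpha>' \<beta>' \<gamma>' d" by unfold_locales
  then show ?thesis by (rule that(1))
next
  case False
  then have "\<beta>' * b2 < \<alpha> * b1" using row_degrees_neq by simp
  then have "\<alpha>' * b1 < \<gamma> * b3" using rel1 by (simp add: algebra_simps)
  then obtain d where "0 < d" "\<alpha>' * b1 + d = \<gamma> * b3" using less_imp_add_positive by blast
  then have "herzog_shift b1 b3 b2 \<alpha>' \<gamma>' \<beta>' \<alpha> \<gamma> \<beta> d"
    using transpose by (simp add: herzog_shift_def herzog_shift_axioms_def)
  then show ?thesis by (rule that(2))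
qed

end

section \<open>From the 2-AGL condition to the matrix and back\<close>

context herzog_shift
begin

lemma is_2AGL_iff_card_D: "is_2AGL H (k :: 'k::field itself) \<longleftrightarrow> card D = 2"
  unfolding nsg.is_2AGL_iff D_def ..

lemma matrix_of_2AGL_of_ge_2:
  assumes "is_2AGL H (k :: 'k::field itself)" "2 \<le> \<alpha>"
  shows "2 \<le> \<alpha>' \<and> (def_ideal b1 b2 b3 :: 'k poly3 set) =
    I2 (mat23 [varX ^ 2, varY, varZ] [varY ^ \<beta>', varZ ^ \<gamma>', varX ^ \<alpha>'])"
  using card_D_2_imp[OF assms(1)[unfolded is_2AGL_iff_card_D] assms(2)] def_ideal_eq[where ?'k = 'k]
  by (simp add: herzog_matrix_def)

end

lemma herzog_shift_matrix_of_2AGL: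
  assumes "herzog_shift a1 a2 a3 \<alpha> \<beta> \<gamma> \<alpha>' \<beta>' \<gamma>' d"
    and agl: "is_2AGL (nsg3 a1 a2 a3) (k :: 'k::field itself)"
  shows "\<exists>b1 b2 b3. mset [b1, b2, b3] = mset [a1, a2, a3] \<and>
       (\<exists>\<alpha> \<beta> \<gamma> :: nat. 2 \<le> \<alpha> \<and> 0 < \<beta> \<and> 0 < \<gamma> \<and>
          (def_ideal b1 b2 b3 :: 'k poly3 set) =
            I2 (mat23 [varX ^ 2, varY, varZ] [varY ^ \<beta>, varZ ^ \<gamma>, varX ^ \<alpha>]))"
    (is "\<exists>b1 b2 b3. ?P b1 b2 b3")
proof -
  interpret A: herzog_shift a1 a2 a3 \<alpha> \<beta> \<gamma> \<alpha>' \<beta>' \<gamma>' d by fact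
  \<comment> \<open>The rotations bring each column to the front, so that the exponent at least 2
    can be taken to be that of the first column.\<close>
  interpret B: herzog_shift a2 a3 a1 \<beta> \<gamma> \<alpha> \<beta>' \<gamma>' \<alpha>' d by (rule A.cyclic_shift)
  interpret C: herzog_shift a3 a1 a2 \<gamma> \<alpha> \<beta> \<gamma>' \<alpha>' \<beta>' d by (rule B.cyclic_shift)
  have m: "mset [a2, a3, a1] = mset [a1, a2, a3]" "mset [a3, a1, a2] = mset [a1, a2, a3]" by auto
  consider "2 \<le> \<alpha>" | "2 \<le> \<beta>" | "2 \<le> \<gamma>"
    using A.card_D_2_nontrivial agl A.is_2AGL_iff_card_D by blast
  then show ?thesis
  proof cases
    case 1
    from A.matrix_of_2AGL_of_ge_2[OF agl this] A.pos have "?P a1 a2 a3" by blast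
    then show ?thesis by blast
  next
    case 2
    from B.matrix_of_2AGL_of_ge_2[OF agl[folded perm_nsg3[OF m(1)]] this] A.pos m
    have "?P a2 a3 a1" by blast
    then show ?thesis by blast
  next
    case 3
    from C.matrix_of_2AGL_of_ge_2[OF agl[folded perm_nsg3[OF m(2)]] this] A.pos m
    have "?P a3 a1 a2" by blast
    then show ?thesis by blast
  qed
qed

text \<open>The first row must have the smaller degrees: otherwise
  \<open>\<alpha> b1 \<le> b3\<close>, \<open>\<gamma> b3 \<le> b2\<close> and \<open>\<beta> b2 \<le> 2 b1\<close> with \<open>\<alpha> \<ge> 2\<close> force \<open>b2 = b3\<close>.\<close>

lemma is_2AGL_of_matrix:
  assumes mg: "min_gen3 b1 b2 b3" and pos: "2 \<le> \<alpha>" "0 < \<beta>" "0 < \<gamma>"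
    and eq: "(def_ideal b1 b2 b3 :: 'k::field poly3 set) =
      I2 (mat23 [varX ^ 2, varY, varZ] [varY ^ \<beta>, varZ ^ \<gamma>, varX ^ \<alpha>])"
  shows "is_2AGL (nsg3 b1 b2 b3) (k :: 'k itself)"
proof -
  have "(def_ideal b1 b2 b3 :: 'k poly3 set) = I2 (herzog_matrix 2 1 1 \<alpha> \<beta> \<gamma>)"
    unfolding eq herzog_matrix_def by simp
  then interpret herzog b1 b2 b3 2 1 1 \<alpha> \<beta> \<gamma>
    using mg pos by (intro herzog_of_def_ideal_eq) auto
  have "2 * b1 < \<beta> * b2"
  proof (rule ccontr)
    assume "\<not> 2 * b1 < \<beta> * b2"
    then have le: "\<beta> * b2 \<le> 2 * b1" by simp
    have "\<gamma> * b3 \<le> b2" "\<alpha> * b1 \<le> b3" using le rel1 rel2 by (simp_all add: algebra_simps)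
    moreover have "2 * b1 \<le> \<alpha> * b1" "b3 \<le> \<gamma> * b3" "b2 \<le> \<beta> * b2" using pos assms(2-4) by simp_all
    ultimately have "b2 = b3" using le by linarith
    moreover have "b2 = b1 * 0 + b2 * 1" by simp
    then have "b2 \<in> nsg2 b1 b2" unfolding nsg2_def by blast
    ultimately show False using mg by (simp add: min_gen3_def)
  qed
  then obtain d where "0 < d" "2 * b1 + d = \<beta> * b2" using less_imp_add_positive by blast
  then interpret herzog_shift b1 b2 b3 2 1 1 \<alpha> \<beta> \<gamma> d by unfold_locales
  show ?thesis
    unfolding is_2AGL_iff_card_D using pos assms(2) by (intro card_D_eq_2) auto
qed

theorem theorem6p4:
  fixes a1 a2 a3 :: nat and k :: "'k::field itself"
  assumes "min_gen3 a1 a2 a3"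
  shows "is_2AGL (nsg3 a1 a2 a3) k \<longleftrightarrow>
    (\<exists>b1 b2 b3. mset [b1, b2, b3] = mset [a1, a2, a3] \<and>
       (\<exists>\<alpha> \<beta> \<gamma> :: nat. 2 \<le> \<alpha> \<and> 0 < \<beta> \<and> 0 < \<gamma> \<and>
          (def_ideal b1 b2 b3 :: 'k poly3 set) =
            I2 (mat23 [varX ^ 2, varY, varZ] [varY ^ \<beta>, varZ ^ \<gamma>, varX ^ \<alpha>])))"
    (is "_ \<longleftrightarrow> ?rhs")
proof
  assume agl: "is_2AGL (nsg3 a1 a2 a3) k"
  then obtain \<alpha> \<beta> \<gamma> \<alpha>' \<beta>' \<gamma>' where "herzog a1 a2 a3 \<alpha> \<beta> \<gamma> \<alpha>' \<beta>' \<gamma>'"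
    using herzog_of_2AGL[OF assms] by blast
  then interpret herzog a1 a2 a3 \<alpha> \<beta> \<gamma> \<alpha>' \<beta>' \<gamma>' .
  show ?rhs
  proof (cases rule: obtain_shift)
    case 1
    then show ?thesis using agl by (rule herzog_shift_matrix_of_2AGL)
  next
    case 2
    \<comment> \<open>The rows were exchanged by swapping the last two generators, a permutation
      which the conclusion allows.\<close>
    have "mset [a1, a3, a2] = mset [a1, a2, a3]" by simp
    with herzog_shift_matrix_of_2AGL[OF 2 agl[unfolded nsg3_swap23[of a1 a2]]] show ?thesis
      by (simp only:)
  qed
next
  assume ?rhs
  then obtain b1 b2 b3 \<alpha> \<beta> \<gamma> where perm: "mset [b1, b2, b3] = mset [a1, a2, a3]"
    and m: "2 \<le> \<alpha>" "0 < \<beta>" "0 < \<gamma>" "(def_ideal b1 b2 b3 :: 'k poly3 set) =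
      I2 (mat23 [varX ^ 2, varY, varZ] [varY ^ \<beta>, varZ ^ \<gamma>, varX ^ \<alpha>])" by blast
  have "min_gen3 b1 b2 b3" using assms perm_min_gen3[OF perm] by simp
  from is_2AGL_of_matrix[OF this m, where k = k] show "is_2AGL (nsg3 a1 a2 a3) k"
    unfolding perm_nsg3[OF perm] .
qed

end
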